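(* Let $f:\mathcal H\to\mathbb R\cup\{+\infty\}$ be a convex, lower semicontinuous, proper function with $\operatorname{argmin} f\neq\emptyset$. Let $\lambda>0$, $c>0$ and $\alpha>3$. Let $(x_k)$ be a sequence in $\mathcal H$ generated from arbitrary $x_0,x_1\in\mathcal H$ by the algorithm (IPATRE-NS): for $k\ge1$, $$y_k=x_k+\left(1-\frac{\alpha}{k}\right)(x_k-x_{k-1}),$$ $$x_{k+1}=\frac{\lambda}{1+\lambda}\left(y_k-\frac{c}{k^2}x_k\right)+\frac{1}{1+\lambda}\operatorname{prox}_{(\lambda+1)f}\left(y_k-\frac{c}{k^2}x_k\right).$$ Then for all $s\in\left[\frac12,1\right[$: (i) $f(\operatorname{prox}_{\lambda f}(x_k))-\min_{\mathcal H} f=o(k^{-2s})$, $\|x_k-x_{k-1}\|=o(k^{-s})$, and $\|x_k-\operatorname{prox}_{\lambda f}(x_k)\|=o(k^{-s})$ as $k\to+\infty$. (ii) $\displaystyle\sum_{k=1}^{+\infty}k^{2s-1}\big(f(\operatorname{prox}_{\lambda f}(x_k))-\min_{\mathcal H} f\big)<+\infty$, $\displaystyle\sum_{k=1}^{+\infty}k^{2s-1}\|x_k-x_{k-1}\|^2<+\infty$, and $\displaystyle\sum_{k=1}^{+\infty}k^{2s}\|x_k-\operatorname{prox}_{\lambda f}(x_k)\|^2<+\infty$. (iii) $\liminf_{k\to+\infty}\|x_k-x^*\|=0$, where $x^*$ is the element of minimum norm of $\operatorname{argmin} f$. Further, $(x_k)$ converges strongly to $x^*$ if $x_k$ is in the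 interior of the ball $B(0,\|x^*\|)$ for all $k$ large enough, or if $x_k$ is in the complement of the ball $B(0,\|x^*\|)$ for all $k$ large enough.
   Context: $\mathcal H$ is a real Hilbert space with norm $\|\cdot\|$. For $\theta>0$, $\operatorname{prox}_{\theta f}(x)=\operatorname{argmin}_{z\in\mathcal H}\{f(z)+\frac{1}{2\theta}\|z-x\|^2\}$. $B(0,\rho)=\{x\in\mathcal H:\|x\|<\rho\}$ is the open ball, so its complement is $\{x:\|x\|\ge\rho\}$. *)

theory Defs
  imports "HOL-Analysis.Analysis" "HOL-Library.Landau_Symbols"
begin

(* Functions into the reals extended by +oo are modelled as ereal-valued functions that never
   take the value -oo; the latter condition is part of proper_fun. *)

definition proper_fun :: "('a \<Rightarrow> ereal) \<Rightarrow> bool" where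
  "proper_fun f \<longleftrightarrow> (\<forall>x. f x \<noteq> -\<infinity>) \<and> (\<exists>x. f x \<noteq> \<infinity>)"

(* The library's convex_on is restricted to real-valued functions. *)
definition convex_fun :: "('a::real_vector \<Rightarrow> ereal) \<Rightarrow> bool" where
  "convex_fun f \<longleftrightarrow>
     (\<forall>x y. \<forall>t::real. 0 < t \<and> t < 1 \<longrightarrow>
        f (t *\<^sub>R x + (1 - t) *\<^sub>R y) \<le> ereal t * f x + ereal (1 - t) * f y)"

definition lsc_fun :: "('a::topological_space \<Rightarrow> ereal) \<Rightarrow> bool" where
  "lsc_fun f \<longleftrightarrow> (\<forall>x. f x \<le> Liminf (at x) f)"

definition argmin_set :: "('a \<Rightarrow> ereal) \<Rightarrow> 'a set" where
  "argmin_set f = {x. is_arg_min f (\<lambda>_. True) x}"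

(* arg_min picks some minimizer; for a proper, convex, lower semicontinuous f on a Hilbert space
   and \<theta> > 0 the minimizer exists and is unique. *)
definition prox :: "real \<Rightarrow> ('a::real_normed_vector \<Rightarrow> ereal) \<Rightarrow> 'a \<Rightarrow> 'a" where
  "prox \<theta> f x = arg_min (\<lambda>z. f z + ereal (1 / (2 * \<theta>) * (norm (z - x))\<^sup>2)) (\<lambda>_. True)"

(* Again a choice that is unique for a nonempty, closed, convex subset of a Hilbert space. *)
definition min_norm_elem :: "'a::real_normed_vector set \<Rightarrow> 'a" where
  "min_norm_elem S = arg_min norm (\<lambda>x. x \<in> S)"

definition ipatre_ns ::
  "('a::real_normed_vector \<Rightarrow> ereal) \<Rightarrow> real \<Rightarrow> real \<Rightarrow> real \<Rightarrow> (nat \<Rightarrow> 'a) \<Rightarrow> (nat \<Rightarrow> 'a) \<Rightarrow> bool" where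
  "ipatre_ns f lam c \<alpha> x y \<longleftrightarrow>
     (\<forall>k\<ge>1.
        y k = x k + (1 - \<alpha> / real k) *\<^sub>R (x k - x (k - 1)) \<and>
        x (k + 1) =
          (lam / (1 + lam)) *\<^sub>R (y k - (c / (real k)\<^sup>2) *\<^sub>R x k)
          + (1 / (1 + lam)) *\<^sub>R prox (lam + 1) f (y k - (c / (real k)\<^sup>2) *\<^sub>R x k))"

(* The infimum is the minimum of f whenever argmin_set f is nonempty. *)
definition gap :: "('a \<Rightarrow> ereal) \<Rightarrow> 'a \<Rightarrow> ereal" where
  "gap f x = f x - (INF z. f z)"

end

theory Submission
  imports Defs "HOL-Real_Asymp.Real_Asymp"
begin

text \<open>
  Write \<open>\<Phi>\<close> for the Moreau envelope of \<open>f\<close> with parameter \<open>lam\<close>, minus \<open>min f\<close>, let \<open>p\<^sub>k\<close> be the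
  proximal point of \<open>x\<^sub>k\<close> and let \<open>g\<^sub>k = (x\<^sub>k - p\<^sub>k) / lam\<close>, the gradient of \<open>\<Phi>\<close> at \<open>x\<^sub>k\<close>.  The
  averaged proximal step of the algorithm is the implicit gradient step of \<open>\<Phi>\<close>
  (\<open>prox_relaxation_step\<close>), so with \<open>d\<^sub>k = x\<^sub>k - x\<^sub>k\<^sub>-\<^sub>1\<close> the iteration reads
  \<open>d\<^sub>k\<^sub>+\<^sub>1 = (1 - \<alpha>/k) d\<^sub>k - g\<^sub>k\<^sub>+\<^sub>1 - (c/k\<^sup>2) x\<^sub>k\<close>,
  a discretisation of \<open>x'' + (\<alpha>/t) x' + \<nabla>\<Phi>(x) + (c/t\<^sup>2) x = 0\<close>.

  In logarithmic time \<open>t = exp \<tau>\<close> this is a heavy ball with constant friction \<open>\<alpha> - 1\<close> in the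
  potential \<open>c/2 |x|\<^sup>2 + t\<^sup>2 \<Phi>(x)\<close>: minimising the norm, under an ever stiffer penalty for leaving
  \<open>argmin f\<close>.  So the iterates should converge to the minimum norm solution \<open>z\<close>.  The energy that
  shows it is, for a constant \<open>b\<close> strictly between \<open>2\<close> and \<open>\<alpha> - 1\<close>,
  \<open>E\<^sub>k = (k-1)\<^sup>2 \<Phi>(x\<^sub>k) + |b (x\<^sub>k\<^sub>-\<^sub>1 - z) + (k-1) d\<^sub>k|\<^sup>2 / 2 + b(\<alpha>-1-b)/2 |x\<^sub>k\<^sub>-\<^sub>1 - z|\<^sup>2 + c/2 (|x\<^sub>k|\<^sup>2 - |z|\<^sup>2)\<close>.
  It satisfies, for some \<open>\<kappa> > 0\<close>, some constant \<open>C\<close> and all large \<open>k\<close> (\<open>E_step\<close>),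
  \<open>E\<^sub>k\<^sub>+\<^sub>1 \<le> (1 - \<kappa>/k) E\<^sub>k + (C/k) \<delta>\<^sub>k - (k\<^sup>2/8) |d\<^sub>k\<^sub>+\<^sub>1 - d\<^sub>k|\<^sup>2\<close> with
  \<open>\<delta>\<^sub>k = max 0 (|z|\<^sup>2 - |x\<^sub>k|\<^sup>2)\<close>.

  Since \<open>\<delta>\<^sub>k \<le> |z|\<^sup>2\<close>, the energy stays bounded, whence \<open>\<Phi>(x\<^sub>k) \<rightarrow> 0\<close>.  A minimising sequence of a
  convex lower semicontinuous function cannot have norms that stay below \<open>|z|\<close> by a fixed amount
  infinitely often (\<open>minimizing_sequence_norm_lower_bound\<close>), so \<open>\<delta>\<^sub>k \<rightarrow> 0\<close>.  As the weights \<open>\<kappa>/k\<close>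
  have a divergent sum, it follows that \<open>E\<^sub>k \<rightarrow> 0\<close> (\<open>contraction_limsup_nonpos\<close>).  Up to a
  multiple of \<open>\<delta>\<^sub>k\<close> the energy dominates each of its first three terms, so \<open>x\<^sub>k \<rightarrow> z\<close>
  strongly, \<open>k |d\<^sub>k| \<rightarrow> 0\<close> and \<open>k\<^sup>2 \<Phi>(x\<^sub>k) \<rightarrow> 0\<close>.

  All the assertions follow: the rates and the first two series from these limits, because
  \<open>\<Sum> k powr (2s - 3)\<close> converges for \<open>s < 1\<close>; the last series from the dissipation of
  \<open>k\<^sup>2 |d\<^sub>k\<^sub>+\<^sub>1 - d\<^sub>k|\<^sup>2\<close> in the energy inequality, because \<open>g\<^sub>k\<^sub>+\<^sub>1\<close> differs from
  \<open>d\<^sub>k - d\<^sub>k\<^sub>+\<^sub>1\<close> by \<open>O(k\<^sup>-\<^sup>2)\<close> only.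
\<close>

section \<open>Nested closed convex sets in a Hilbert space\<close>

text \<open>
  This replaces weak compactness throughout.  Let \<open>m\<^sub>n\<close> be the distance from the origin to
  \<open>C\<^sub>n\<close>; these distances increase to some finite \<open>M\<close>.  Midpoints of nearly norm-minimal points of
  \<open>C\<^sub>n\<close> and \<open>C\<^sub>l\<close>, \<open>n \<le> l\<close>, stay in \<open>C\<^sub>n\<close> and so have norm at least \<open>m\<^sub>n\<close>; by the parallelogram law such
  points form a Cauchy sequence, whose limit lies in every \<open>C\<^sub>n\<close> and has norm \<open>M\<close>.  The conclusion
  compares with every bound \<open>q\<close>, so for a constant family it gives the element of least norm.
\<close>

lemma nested_convex_min_norm_point:
  fixes C :: "nat \<Rightarrow> 'a::{real_inner,complete_space} set"
  assumes clo: "\<And>n. closed (C n)" and conv: "\<And>n. convex (C n)" and dec: "decseq C"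
    and ex: "\<And>n. \<exists>v\<in>C n. norm v \<le> q0"
  shows "\<exists>u\<in>(\<Inter>n. C n). \<forall>q. (\<forall>n. \<exists>v\<in>C n. norm v \<le> q) \<longrightarrow> norm u \<le> q"
proof -
  define m where "m n = Inf (norm ` C n)" for n
  have bdd: "bdd_below (norm ` C n)" for n by (rule bdd_belowI[of _ 0]) auto
  have ne: "norm ` C n \<noteq> {}" for n using ex[of n] by auto
  have mle: "m n \<le> norm v" if "v \<in> C n" for n v
    unfolding m_def using that bdd by (simp add: cInf_lower)
  have mq: "m n \<le> q" if "\<forall>n. \<exists>v\<in>C n. norm v \<le> q" for n q
    using that mle[of _ n] by (meson order_trans)
  have m0: "0 \<le> m n" for n
    unfolding m_def using ne[of n] by (intro cInf_greatest) auto
  have inc: "incseq m"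
    unfolding incseq_def m_def using dec ne bdd
    by (auto intro!: cInf_superset_mono image_mono simp: decseq_def)
  have "\<exists>M. m \<longlonglongrightarrow> M"
    using incseq_convergent[OF inc, of q0] mq[of q0] ex by metis
  then obtain M where M: "m \<longlonglongrightarrow> M" by blast
  have "\<exists>v\<in>C n. norm v < m n + 1 / real (Suc n)" for n
  proof -
    have "Inf (norm ` C n) < m n + 1 / real (Suc n)" by (simp add: m_def)
    then show ?thesis using cInf_lessD[OF ne] by blast
  qed
  then obtain u where u: "\<And>n. u n \<in> C n" "\<And>n. norm (u n) < m n + 1 / real (Suc n)"
    by metis
  have uC: "u l \<in> C n" if "n \<le> l" for n l
    using u(1)[of l] dec that by (auto simp: decseq_def)
  have lim_norm: "(\<lambda>n. norm (u n)) \<longlonglongrightarrow> M"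
  proof (rule tendsto_sandwich[OF _ _ M])
    show "\<forall>\<^sub>F n in sequentially. m n \<le> norm (u n)" using mle u(1) by simp
    show "\<forall>\<^sub>F n in sequentially. norm (u n) \<le> m n + 1 / real (Suc n)"
      using u(2) by (simp add: less_imp_le)
    show "(\<lambda>n. m n + 1 / real (Suc n)) \<longlonglongrightarrow> M"
      using tendsto_add[OF M LIMSEQ_Suc[OF lim_1_over_n]] by simp
  qed
  have par: "(norm (u n - u l))\<^sup>2 \<le> 2 * (norm (u n))\<^sup>2 + 2 * (norm (u l))\<^sup>2 - 4 * (m n)\<^sup>2"
    if "n \<le> l" for n l
  proof -
    have "(1/2) *\<^sub>R u n + (1/2) *\<^sub>R u l \<in> C n"
      using conv[of n] u(1)[of n] uC[OF that] by (auto simp: convex_def)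
    then have "m n \<le> norm ((1/2) *\<^sub>R (u n + u l))"
      using mle by (simp add: scaleR_add_right)
    then have "2 * m n \<le> norm (u n + u l)" by simp
    then have "(2 * m n)\<^sup>2 \<le> (norm (u n + u l))\<^sup>2" using m0[of n] by (intro power_mono) auto
    moreover have "(norm (u n - u l))\<^sup>2 + (norm (u n + u l))\<^sup>2
        = 2 * (norm (u n))\<^sup>2 + 2 * (norm (u l))\<^sup>2"
      by (simp add: power2_norm_eq_inner algebra_simps inner_commute)
    ultimately show ?thesis by (simp add: power_mult_distrib)
  qed
  have "Cauchy u"
  proof (rule metric_CauchyI)
    fix e :: real assume e: "0 < e"
    define d where "d = e\<^sup>2 / 16"
    have d: "d > 0" using e by (simp add: d_def)
    have "\<forall>\<^sub>F n in sequentially. (norm (u n))\<^sup>2 < M\<^sup>2 + d"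
      by (rule order_tendstoD[OF tendsto_power[OF lim_norm]]) (use d in simp)
    moreover have "\<forall>\<^sub>F n in sequentially. M\<^sup>2 - d < (m n)\<^sup>2"
      by (rule order_tendstoD[OF tendsto_power[OF M]]) (use d in simp)
    ultimately have "\<forall>\<^sub>F n in sequentially. (norm (u n))\<^sup>2 < M\<^sup>2 + d \<and> M\<^sup>2 - d < (m n)\<^sup>2"
      by (rule eventually_conj)
    then obtain N where N: "\<And>n. n \<ge> N \<Longrightarrow> (norm (u n))\<^sup>2 < M\<^sup>2 + d \<and> M\<^sup>2 - d < (m n)\<^sup>2"
      by (auto simp: eventually_sequentially)
    have *: "dist (u n) (u l) < e" if "N \<le> n" "n \<le> l" for n l
    proof -
      have "(norm (u n - u l))\<^sup>2 < e\<^sup>2"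
        using par[OF that(2)] N[OF that(1)] N[OF order_trans[OF that]] zero_less_power[OF e, of 2]
        unfolding d_def by linarith
      then show ?thesis using e by (simp add: dist_norm power_less_imp_less_base)
    qed
    have "dist (u n) (u l) < e" if "N \<le> n" "N \<le> l" for n l
      using *[of n l] *[of l n] that by (cases "n \<le> l") (auto simp: dist_commute)
    then show "\<exists>N. \<forall>m\<ge>N. \<forall>n\<ge>N. dist (u m) (u n) < e" by blast
  qed
  then obtain w where w: "u \<longlonglongrightarrow> w"
    using Cauchy_convergent convergent_def by blast
  have "w \<in> C n" for n
  proof (rule Lim_in_closed_set[OF clo _ _ w])
    show "\<forall>\<^sub>F l in sequentially. u l \<in> C n"
      using uC by (auto simp: eventually_sequentially)
  qed simp
  moreover have "norm w = M"
    using LIMSEQ_unique[OF tendsto_norm[OF w] lim_norm] .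
  ultimately show ?thesis
    using mq LIMSEQ_le_const2[OF M] by blast
qed

section \<open>Sublevel sets of extended-real convex functions\<close>

lemma lsc_fun_open_superlevel:
  assumes "lsc_fun f"
  shows "open {z. ereal a < f z}"
proof (subst open_subopen, rule ballI)
  have *: "\<exists>T. open T \<and> z \<in> T \<and> (\<forall>w\<in>T. ereal a < f w)" if "ereal a < f z" for z
  proof -
    have "ereal a < Liminf (at z) f"
      using assms that unfolding lsc_fun_def by (meson less_le_trans)
    then have "\<forall>\<^sub>F w in at z. ereal a < f w" by (rule less_LiminfD)
    then show ?thesis using that by (auto simp: eventually_at_topological)
  qed
  show "\<exists>T. open T \<and> x \<in> T \<and> T \<subseteq> {z. ereal a < f z}" if "x \<in> {z. ereal a < f z}" for x
    using *[of x] that by blast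
qed

lemma closed_sublevel_add:
  fixes f :: "'a::real_normed_vector \<Rightarrow> ereal"
  assumes "lsc_fun f" and q: "continuous_on UNIV q"
  shows "closed {z. f z + ereal (q z) \<le> ereal a}"
proof -
  \<comment> \<open>Splitting the strict inequality at a real \<open>r\<close> exhibits the complement as a union of open sets.\<close>
  have "(\<not> f z + ereal (q z) \<le> ereal a) \<longleftrightarrow> (\<exists>r. ereal r < f z \<and> a - r < q z)" for z
  proof (cases "f z")
    case (real v)
    have "(\<exists>r. r < v \<and> a - r < q z) \<longleftrightarrow> a < v + q z"
    proof
      assume "a < v + q z"
      then show "\<exists>r. r < v \<and> a - r < q z"
        by (intro exI[of _ "(v + a - q z) / 2"]) (simp add: field_simps)
    qed auto
    then show ?thesis using real by (auto simp: not_le)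
  next
    case PInf
    then show ?thesis by (auto intro!: exI[of _ "a - q z + 1"])
  next
    case MInf
    then show ?thesis by auto
  qed
  then have "- {z. f z + ereal (q z) \<le> ereal a}
      = (\<Union>r. {z. ereal r < f z} \<inter> {z. a - r < q z})" by auto
  moreover have "open (\<Union>r. {z. ereal r < f z} \<inter> {z. a - r < q z})"
    by (intro open_UN ballI open_Int lsc_fun_open_superlevel[OF assms(1)]
        open_Collect_less q continuous_on_const)
  ultimately show ?thesis by (simp add: closed_def)
qed

lemma proper_finite_le:
  assumes "proper_fun f" "f z + ereal q \<le> ereal a"
  obtains v where "f z = ereal v" "v + q \<le> a"
  using assms by (cases "f z") (auto simp: proper_fun_def)

lemma convex_fun_realD:
  assumes "proper_fun f" "convex_fun f" "f x = ereal u" "f y = ereal v" "0 < t" "t < 1"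
  obtains w where "f (t *\<^sub>R x + (1 - t) *\<^sub>R y) = ereal w" "w \<le> t * u + (1 - t) * v"
proof -
  have "f (t *\<^sub>R x + (1 - t) *\<^sub>R y) \<le> ereal (t * u + (1 - t) * v)"
    using assms unfolding convex_fun_def by (metis plus_ereal.simps(1) times_ereal.simps(1))
  then show ?thesis using that proper_finite_le[OF assms(1), of _ 0] by (metis add.right_neutral ereal_eq_0(2) zero_ereal_def)
qed

lemma convex_sublevel_add:
  fixes f :: "'a::real_normed_vector \<Rightarrow> ereal"
  assumes f: "proper_fun f" "convex_fun f" and q: "convex_on UNIV q"
  shows "convex {z. f z + ereal (q z) \<le> ereal a}"
proof -
  have "f (t *\<^sub>R x + (1 - t) *\<^sub>R y) + ereal (q (t *\<^sub>R x + (1 - t) *\<^sub>R y)) \<le> ereal a"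
    if x: "f x + ereal (q x) \<le> ereal a" and y: "f y + ereal (q y) \<le> ereal a"
      and t: "0 \<le> t" "t \<le> 1" for x y t
  proof (cases "t = 0 \<or> t = 1")
    case True
    then show ?thesis using x y by auto
  next
    case False
    then have t': "0 < t" "t < 1" using t by auto
    obtain u v where uv: "f x = ereal u" "u + q x \<le> a" "f y = ereal v" "v + q y \<le> a"
      using proper_finite_le[OF f(1)] x y by metis
    obtain w where w: "f (t *\<^sub>R x + (1 - t) *\<^sub>R y) = ereal w" "w \<le> t * u + (1 - t) * v"
      using convex_fun_realD[OF f uv(1,3) t'] .
    have "q (t *\<^sub>R x + (1 - t) *\<^sub>R y) \<le> t * q x + (1 - t) * q y"
      using q t by (auto simp: convex_on_def)
    moreover have "t * (u + q x) + (1 - t) * (v + q y) \<le> t * a + (1 - t) * a"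
      using uv t by (intro add_mono mult_left_mono) auto
    ultimately show ?thesis using w by (simp add: algebra_simps)
  qed
  then show ?thesis
    by (auto simp: convex_alt) (metis add.commute)
qed

lemma convex_on_norm_square_diff:
  fixes x :: "'a::real_inner"
  assumes "0 \<le> a"
  shows "convex_on UNIV (\<lambda>z. a * (norm (z - x))\<^sup>2)"
proof -
  have "a * (norm ((1 - t) *\<^sub>R y + t *\<^sub>R z - x))\<^sup>2
      \<le> (1 - t) * (a * (norm (y - x))\<^sup>2) + t * (a * (norm (z - x))\<^sup>2)"
    if t: "0 < t" "t < 1" for y z t
  proof -
    have "(1 - t) * (a * (norm (y - x))\<^sup>2) + t * (a * (norm (z - x))\<^sup>2)
        - a * (norm ((1 - t) *\<^sub>R y + t *\<^sub>R z - x))\<^sup>2 = a * (t * (1 - t)) * (norm (y - z))\<^sup>2"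
      by (simp add: power2_norm_eq_inner inner_diff_left inner_diff_right inner_add_left inner_add_right inner_commute)
         (simp add: algebra_simps inner_commute)
    moreover have "0 \<le> a * (t * (1 - t)) * (norm (y - z))\<^sup>2" using assms t by simp
    ultimately show ?thesis by linarith
  qed
  then show ?thesis by (intro convex_onI) auto
qed

section \<open>Proximal points, subgradients and the Moreau envelope\<close>

definition subgradient :: "('a::real_inner \<Rightarrow> ereal) \<Rightarrow> 'a \<Rightarrow> 'a \<Rightarrow> bool" where
  "subgradient f g p \<longleftrightarrow> \<bar>f p\<bar> \<noteq> \<infinity> \<and> (\<forall>z. f p + ereal (g \<bullet> (z - p)) \<le> f z)"

text \<open>
  The sublevel sets at heights \<open>i + 1/(n+1)\<close> above the infimum \<open>i\<close> are closed, convex, nested and,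
  because \<open>f\<close> is bounded below and the quadratic term is coercive, meet a common ball.  So they have
  a common point.
\<close>

lemma prox_objective_has_minimizer:
  fixes f :: "'a::{real_inner,complete_space} \<Rightarrow> ereal"
  assumes f: "proper_fun f" "convex_fun f" "lsc_fun f"
    and m: "\<And>z. ereal m \<le> f z" and \<theta>: "0 < \<theta>"
  shows "\<exists>p. is_arg_min (\<lambda>z. f z + ereal (1 / (2 * \<theta>) * (norm (z - x))\<^sup>2)) (\<lambda>_. True) p"
proof -
  define q where "q z = 1 / (2 * \<theta>) * (norm (z - x))\<^sup>2" for z
  define F where "F z = f z + ereal (q z)" for z
  define C where "C n = {z. F z \<le> ereal (real_of_ereal (Inf (range F)) + 1 / real (Suc n))}" for n
  have q0: "0 \<le> q z" for z using \<theta> by (simp add: q_def)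
  have Fm: "ereal m \<le> F z" for z
    unfolding F_def using add_mono[OF m[of z], of 0 "ereal (q z)"] q0 by simp
  obtain z0 where "f z0 \<noteq> \<infinity>" using f(1) by (auto simp: proper_fun_def)
  then have "Inf (range F) \<noteq> \<infinity>"
    using m[of z0] Inf_lower[of "F z0" "range F"] by (auto simp: F_def)
  moreover have "ereal m \<le> Inf (range F)" using Fm by (auto intro: INF_greatest)
  ultimately obtain i where i: "Inf (range F) = ereal i"
    by (cases "Inf (range F)") auto
  have Ceq: "C n = {z. f z + ereal (q z) \<le> ereal (i + 1 / real (Suc n))}" for n
    unfolding C_def i F_def by simp
  have "closed (C n)" for n unfolding Ceq
    by (rule closed_sublevel_add[OF f(3)]) (use \<theta> in \<open>auto simp: q_def intro!: continuous_intros\<close>)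
  moreover have "convex (C n)" for n unfolding Ceq
    by (rule convex_sublevel_add[OF f(1,2)])
       (use \<theta> in \<open>simp add: q_def convex_on_norm_square_diff del: times_divide_eq_left mult_1\<close>)
  moreover have "decseq C" unfolding decseq_def
  proof (intro allI impI subsetI)
    fix k n z assume "k \<le> n" "z \<in> C n"
    then have "F z \<le> ereal (i + 1 / real (Suc n))" by (simp add: C_def i)
    also have "\<dots> \<le> ereal (i + 1 / real (Suc k))"
      using \<open>k \<le> n\<close> by (auto simp: frac_le)
    finally show "z \<in> C k" by (simp add: C_def i)
  qed
  moreover have "\<exists>v\<in>C n. norm v \<le> norm x + sqrt (2 * \<theta> * (i + 1 - m))" for n
  proof -
    have "Inf (range F) < ereal (i + 1 / real (Suc n))" by (simp add: i)
    then obtain v where v: "F v < ereal (i + 1 / real (Suc n))"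
      by (auto simp: Inf_less_iff)
    then obtain w where w: "f v = ereal w" "w + q v \<le> i + 1 / real (Suc n)"
      using proper_finite_le[OF f(1) less_imp_le[OF v[unfolded F_def]]] by metis
    have "1 / real (Suc n) \<le> 1" by simp
    then have "q v \<le> i + 1 - m" using w(2) m[of v] unfolding w(1) ereal_less_eq by linarith
    then have "(norm (v - x))\<^sup>2 \<le> 2 * \<theta> * (i + 1 - m)"
      using \<theta> by (simp add: q_def field_simps)
    then have "norm (v - x) \<le> sqrt (2 * \<theta> * (i + 1 - m))" by (rule real_le_rsqrt)
    moreover have "norm v \<le> norm x + norm (v - x)" by (metis add.commute diff_add_cancel norm_triangle_ineq)
    ultimately show ?thesis using v by (intro bexI[of _ v]) (auto simp: C_def i less_imp_le)
  qed
  ultimately obtain p where p: "\<And>n. p \<in> C n"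
    using nested_convex_min_norm_point[of C "norm x + sqrt (2 * \<theta> * (i + 1 - m))"] by fast
  obtain w where w: "F p = ereal w" "\<And>n. w \<le> i + 1 / real (Suc n)"
  proof -
    obtain w where "f p = ereal w"
      using proper_finite_le[OF f(1)] p[of 0] unfolding Ceq by blast
    then show ?thesis using that[of "w + q p"] p by (auto simp: Ceq F_def)
  qed
  have "w \<le> i + 0"
    by (rule LIMSEQ_le_const[OF tendsto_add[OF tendsto_const LIMSEQ_Suc[OF lim_1_over_n]]])
       (use w in auto)
  then have "F p \<le> Inf (range F)" using w i by simp
  then have "F p \<le> F z" for z by (meson INF_lower UNIV_I order_trans)
  then show ?thesis by (auto simp: is_arg_min_linorder F_def q_def)
qed

lemma norm_square_diff_expand:
  fixes z p x :: "'a::real_inner"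
  shows "(norm (z - x))\<^sup>2 = (norm (p - x))\<^sup>2 + 2 * ((p - x) \<bullet> (z - p)) + (norm (z - p))\<^sup>2"
  by (simp add: power2_norm_eq_inner algebra_simps inner_commute)

text \<open>
  By the subgradient inequality the proximal objective at \<open>z\<close> exceeds its value at \<open>p\<close> by at least
  \<open>|z - p|\<^sup>2 / (2 \<theta>)\<close>, so \<open>p\<close> is the only minimiser and every choice operator must return it.
\<close>

lemma subgradient_imp_prox_eq:
  fixes f :: "'a::real_inner \<Rightarrow> ereal"
  assumes \<theta>: "0 < \<theta>" and sg: "subgradient f ((1 / \<theta>) *\<^sub>R (x - p)) p"
  shows "prox \<theta> f x = p"
proof -
  define F where "F z = f z + ereal (1 / (2 * \<theta>) * (norm (z - x))\<^sup>2)" for z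
  obtain v where v: "f p = ereal v" using sg by (auto simp: subgradient_def)
  have key: "F p + ereal (1 / (2 * \<theta>) * (norm (z - p))\<^sup>2) \<le> F z" for z
  proof -
    have "f p + ereal ((1 / \<theta>) *\<^sub>R (x - p) \<bullet> (z - p)) \<le> f z"
      using sg by (simp add: subgradient_def)
    then have "f p + ereal ((1 / \<theta>) *\<^sub>R (x - p) \<bullet> (z - p))
        + ereal (1 / (2 * \<theta>) * (norm (z - x))\<^sup>2) \<le> F z"
      unfolding F_def by (rule add_right_mono)
    moreover have "(1 / \<theta>) *\<^sub>R (x - p) \<bullet> (z - p) + 1 / (2 * \<theta>) * (norm (z - x))\<^sup>2
        = 1 / (2 * \<theta>) * (norm (p - x))\<^sup>2 + 1 / (2 * \<theta>) * (norm (z - p))\<^sup>2"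
      unfolding norm_square_diff_expand[of z x p] using \<theta>
      by (simp add: field_simps inner_diff_left)
    ultimately show ?thesis by (simp add: F_def v add.assoc)
  qed
  have le: "F p \<le> F z" for z
    using key[of z] \<theta> by (auto simp: F_def v intro: order_trans[rotated])
  have "z = p" if "F z \<le> F p" for z
  proof -
    have "F p + ereal (1 / (2 * \<theta>) * (norm (z - p))\<^sup>2) \<le> F p"
      using key[of z] that by (rule order_trans)
    then have "1 / (2 * \<theta>) * (norm (z - p))\<^sup>2 \<le> 0" by (simp add: F_def v)
    then show ?thesis using \<theta> by (simp add: field_simps)
  qed
  then have "is_arg_min F (\<lambda>_. True) = (\<lambda>z. z = p)"
    using le by (auto simp: is_arg_min_linorder fun_eq_iff)
  then have "arg_min F (\<lambda>_. True) = p" unfolding arg_min_def by simp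
  then show ?thesis unfolding prox_def F_def .
qed

text \<open>
  Optimality condition for the proximal point: compare it with the points \<open>t z + (1 - t) p\<close>, divide
  by \<open>t\<close> and let \<open>t\<close> tend to \<open>0\<close> from above, so that the second-order term disappears.
\<close>

lemma prox_subgradient:
  fixes f :: "'a::{real_inner,complete_space} \<Rightarrow> ereal"
  assumes f: "proper_fun f" "convex_fun f" "lsc_fun f"
    and m: "\<And>z. ereal m \<le> f z" and \<theta>: "0 < \<theta>"
  shows "subgradient f ((1 / \<theta>) *\<^sub>R (x - prox \<theta> f x)) (prox \<theta> f x)"
proof -
  define p where "p = prox \<theta> f x"
  define F where "F z = f z + ereal (1 / (2 * \<theta>) * (norm (z - x))\<^sup>2)" for z
  have "is_arg_min F (\<lambda>_. True) p"
    using someI_ex[OF prox_objective_has_minimizer[OF f m \<theta>, of x]]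
    unfolding F_def p_def prox_def arg_min_def .
  then have min: "F p \<le> F z" for z by (simp add: is_arg_min_linorder)
  obtain z0 where z0: "f z0 \<noteq> \<infinity>" using f(1) by (auto simp: proper_fun_def)
  have "F p \<noteq> \<infinity>" using min[of z0] z0 by (auto simp: F_def)
  then obtain v where v: "f p = ereal v" using m[of p] by (cases "f p") (auto simp: F_def)
  have "f p + ereal ((1 / \<theta>) *\<^sub>R (x - p) \<bullet> (z - p)) \<le> f z" for z
  proof (cases "f z")
    case (real w)
    define a where "a = v + ((1 / \<theta>) *\<^sub>R (x - p)) \<bullet> (z - p) - w"
    define b where "b = 1 / (2 * \<theta>) * (norm (z - p))\<^sup>2"
    have *: "a \<le> t * b" if t: "0 < t" "t < 1" for t
    proof -
      obtain u where u: "f (t *\<^sub>R z + (1 - t) *\<^sub>R p) = ereal u" "u \<le> t * w + (1 - t) * v"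
        using convex_fun_realD[OF f(1,2) real v t] .
      have "v + 1 / (2 * \<theta>) * (norm (p - x))\<^sup>2
          \<le> u + 1 / (2 * \<theta>) * (norm (t *\<^sub>R z + (1 - t) *\<^sub>R p - x))\<^sup>2"
        using min[of "t *\<^sub>R z + (1 - t) *\<^sub>R p"] by (simp add: F_def u v)
      moreover have "t *\<^sub>R z + (1 - t) *\<^sub>R p - p = t *\<^sub>R (z - p)" by (simp add: algebra_simps)
      then have "(norm (t *\<^sub>R z + (1 - t) *\<^sub>R p - p))\<^sup>2 = t\<^sup>2 * (norm (z - p))\<^sup>2"
          and "(p - x) \<bullet> (t *\<^sub>R z + (1 - t) *\<^sub>R p - p) = t * ((p - x) \<bullet> (z - p))"
        by (simp_all add: power_mult_distrib)
      then have "1 / (2 * \<theta>) * (norm (t *\<^sub>R z + (1 - t) *\<^sub>R p - x))\<^sup>2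
          = 1 / (2 * \<theta>) * (norm (p - x))\<^sup>2 - t * (((1 / \<theta>) *\<^sub>R (x - p)) \<bullet> (z - p)) + t\<^sup>2 * b"
        unfolding norm_square_diff_expand[of "t *\<^sub>R z + (1 - t) *\<^sub>R p" x p] b_def using \<theta>
        by (simp add: field_simps inner_diff_left)
      ultimately have "t * a \<le> t * (t * b)"
        using u(2) unfolding a_def by (simp add: algebra_simps power2_eq_square)
      then show ?thesis using t by simp
    qed
    have "((\<lambda>t. t * b) \<longlongrightarrow> 0 * b) (at_right 0)"
      by (intro tendsto_intros)
    moreover have "\<forall>\<^sub>F t in at_right 0. a \<le> t * b"
      using * by (auto simp: eventually_at_right[of 0 1] intro!: exI[of _ 1])
    ultimately have "a \<le> 0 * b" by (rule tendsto_lowerbound) simp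
    then show ?thesis by (simp add: v real a_def)
  next
    case PInf
    then show ?thesis by simp
  next
    case MInf
    then show ?thesis using f(1) by (auto simp: proper_fun_def)
  qed
  then show ?thesis by (auto simp: subgradient_def p_def[symmetric] v)
qed

lemma min_norm_elem_argmin_set:
  fixes f :: "'a::{real_inner,complete_space} \<Rightarrow> ereal"
  assumes f: "proper_fun f" "convex_fun f" "lsc_fun f" and z: "f z = ereal m" and m: "\<And>z. ereal m \<le> f z"
  shows "f (min_norm_elem (argmin_set f)) = ereal m"
    and "f w \<le> ereal m \<Longrightarrow> norm (min_norm_elem (argmin_set f)) \<le> norm w"
proof -
  have S: "argmin_set f = {w. f w + ereal 0 \<le> ereal m}"
  proof -
    have "(\<forall>y. f w \<le> f y) \<longleftrightarrow> f w \<le> ereal m" for w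
      using m z order_trans by metis
    then show ?thesis by (simp add: argmin_set_def is_arg_min_linorder)
  qed
  have "closed (argmin_set f)" unfolding S by (rule closed_sublevel_add[OF f(3)]) simp
  moreover have "convex (argmin_set f)"
    unfolding S by (rule convex_sublevel_add[OF f(1,2)]) (simp add: convex_on_const)
  moreover have zS: "z \<in> argmin_set f" by (simp add: S z)
  ultimately obtain u where u: "u \<in> argmin_set f"
      "\<And>q. (\<exists>v\<in>argmin_set f. norm v \<le> q) \<Longrightarrow> norm u \<le> q"
    using nested_convex_min_norm_point[of "\<lambda>_. argmin_set f" "norm z"] by auto
  then have "is_arg_min norm (\<lambda>x. x \<in> argmin_set f) u"
    by (auto simp: is_arg_min_linorder)
  then have *: "is_arg_min norm (\<lambda>x. x \<in> argmin_set f) (min_norm_elem (argmin_set f))"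
    unfolding min_norm_elem_def arg_min_def by (rule someI)
  then show "f (min_norm_elem (argmin_set f)) = ereal m"
    using m by (auto simp: S is_arg_min_linorder intro: antisym)
  show "norm (min_norm_elem (argmin_set f)) \<le> norm w" if "f w \<le> ereal m"
    using * that by (auto simp: S is_arg_min_linorder)
qed

text \<open>
  The form in which weak lower semicontinuity of the norm enters: if \<open>|p\<^sub>k| \<le> q\<close> for infinitely many
  \<open>k\<close>, then every sublevel set above the minimum \<open>m\<close> meets the ball of radius \<open>q\<close>, hence so does
  their intersection, the set of minimisers.
\<close>

lemma minimizing_sequence_norm_lower_bound:
  fixes f :: "'a::{real_inner,complete_space} \<Rightarrow> ereal" and p :: "nat \<Rightarrow> 'a"
  assumes f: "proper_fun f" "convex_fun f" "lsc_fun f" and m: "\<And>z. ereal m \<le> f z"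
    and min: "\<And>w. f w \<le> ereal m \<Longrightarrow> R \<le> norm w"
    and conv: "\<And>e. 0 < e \<Longrightarrow> \<forall>\<^sub>F k in sequentially. f (p k) \<le> ereal (m + e)"
    and q: "q < R"
  shows "\<forall>\<^sub>F k in sequentially. q < norm (p k)"
proof (rule ccontr)
  assume "\<not> (\<forall>\<^sub>F k in sequentially. q < norm (p k))"
  then have freq: "\<exists>\<^sub>F k in sequentially. norm (p k) \<le> q"
    by (simp add: not_eventually not_less)
  define C where "C n = {z. f z + ereal 0 \<le> ereal (m + 1 / real (Suc n))}" for n
  have "closed (C n)" for n unfolding C_def by (rule closed_sublevel_add[OF f(3)]) simp
  moreover have "convex (C n)" for n
    unfolding C_def by (rule convex_sublevel_add[OF f(1,2)]) (simp add: convex_on_const)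
  moreover have "decseq C" unfolding decseq_def
  proof (intro allI impI subsetI)
    fix k n z assume "k \<le> n" "z \<in> C n"
    then have "f z \<le> ereal (m + 1 / real (Suc n))" by (simp add: C_def)
    also have "\<dots> \<le> ereal (m + 1 / real (Suc k))" using \<open>k \<le> n\<close> by (auto simp: frac_le)
    finally show "z \<in> C k" by (simp add: C_def)
  qed
  moreover have ex: "\<exists>v\<in>C n. norm v \<le> q" for n
  proof -
    have "\<exists>\<^sub>F k in sequentially. norm (p k) \<le> q \<and> f (p k) \<le> ereal (m + 1 / real (Suc n))"
      using frequently_eventually_conj[OF freq conv[of "1 / real (Suc n)"]] by (simp add: conj_commute)
    then obtain k where "norm (p k) \<le> q \<and> f (p k) \<le> ereal (m + 1 / real (Suc n))"
      by (auto dest: frequently_ex)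
    then show ?thesis by (auto simp: C_def)
  qed
  ultimately have "\<exists>u\<in>(\<Inter>n. C n). \<forall>q. (\<forall>n. \<exists>v\<in>C n. norm v \<le> q) \<longrightarrow> norm u \<le> q"
    by (rule nested_convex_min_norm_point)
  then obtain u where u: "\<And>n. u \<in> C n" "norm u \<le> q"
    using ex by auto
  obtain v where v: "f u = ereal v"
    using proper_finite_le[OF f(1)] u(1)[of 0] unfolding C_def by blast
  have "v \<le> m + 0"
    by (rule LIMSEQ_le_const[OF tendsto_add[OF tendsto_const LIMSEQ_Suc[OF lim_1_over_n]]])
       (use u(1) v in \<open>auto simp: C_def\<close>)
  then show False using min[of u] v u(2) q by simp
qed

text \<open>
  Convexity of the Moreau envelope, whose value at \<open>u\<close> is \<open>f p + |u - p|\<^sup>2 / (2 lam)\<close> when \<open>p\<close> is the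
  proximal point of \<open>u\<close>.  The subgradient inequality between \<open>q\<close> and \<open>p\<close> in fact leaves
  the surplus \<open>lam/2 |g - h|\<^sup>2\<close> for the two gradients \<open>g\<close> and \<open>h\<close>.
\<close>

lemma moreau_envelope_gradient_inequality:
  fixes f :: "'a::real_inner \<Rightarrow> ereal"
  assumes lam: "0 < lam" and sg: "subgradient f ((1 / lam) *\<^sub>R (v - q)) q"
    and fp: "f p = ereal a" and fq: "f q = ereal b"
  shows "((1 / lam) *\<^sub>R (v - q)) \<bullet> (u - v)
    \<le> (a + (norm (u - p))\<^sup>2 / (2 * lam)) - (b + (norm (v - q))\<^sup>2 / (2 * lam))"
proof -
  define g h where "g = (1 / lam) *\<^sub>R (v - q)" and "h = (1 / lam) *\<^sub>R (u - p)"
  have vq: "v = q + lam *\<^sub>R g" "u = p + lam *\<^sub>R h" using lam by (auto simp: g_def h_def)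
  have "b + g \<bullet> (p - q) \<le> a" using sg fp fq unfolding subgradient_def g_def by (metis ereal_less_eq(3) plus_ereal.simps(1))
  moreover have "(norm (u - p))\<^sup>2 / (2 * lam) = lam / 2 * (h \<bullet> h)"
     "(norm (v - q))\<^sup>2 / (2 * lam) = lam / 2 * (g \<bullet> g)"
    using lam by (simp_all add: vq power_mult_distrib power2_norm_eq_inner power2_eq_square[of lam])
  moreover have "0 \<le> lam / 2 * ((g - h) \<bullet> (g - h))" using lam by simp
  moreover have "g \<bullet> (u - v) = g \<bullet> (p - q) + lam * (g \<bullet> h) - lam * (g \<bullet> g)"
    by (simp add: vq algebra_simps)
  ultimately show ?thesis unfolding g_def[symmetric]
    by (simp add: algebra_simps inner_commute)
qed

section \<open>Scalar recursions with harmonic contraction\<close>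

text \<open>
  The value \<open>D / \<kappa>\<close> is the equilibrium of the recursion.  The condition \<open>\<kappa> \<le> K\<close> makes the factor
  \<open>1 - \<kappa> / k\<close> nonnegative.
\<close>

lemma contraction_bounded:
  fixes E :: "nat \<Rightarrow> real"
  assumes \<kappa>: "0 < \<kappa>" and K: "\<kappa> \<le> real K" "0 < K"
    and step: "\<And>k. K \<le> k \<Longrightarrow> E (Suc k) \<le> E k - \<kappa> / real k * E k + D / real k"
    and k: "K \<le> k"
  shows "E k \<le> max (E K) (D / \<kappa>)"
  using k
proof (induction k rule: dec_induct)
  case (step n)
  define M where "M = max (E K) (D / \<kappa>)"
  have n: "0 < real n" "\<kappa> / real n \<le> 1" using step(1) K by auto
  have "D / \<kappa> \<le> M" by (simp add: M_def)
  then have "D / real n \<le> \<kappa> / real n * M" using n \<kappa> by (simp add: field_simps)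
  moreover have "(1 - \<kappa> / real n) * E n \<le> (1 - \<kappa> / real n) * M"
    using step n by (intro mult_left_mono) (auto simp: M_def)
  ultimately show ?case
    using assms(4)[of n] step(1) unfolding M_def[symmetric] by (simp add: algebra_simps)
qed simp

text \<open>
  As long as \<open>E k\<close> exceeds \<open>\<epsilon>\<close>, it drops by at least \<open>\<kappa> \<epsilon> / (2 k)\<close>; the harmonic series diverges, so
  \<open>E\<close> must reach \<open>\<epsilon>\<close>, and from then on \<open>contraction_bounded\<close> keeps it there.
\<close>

lemma contraction_limsup_nonpos:
  fixes E D :: "nat \<Rightarrow> real"
  assumes \<kappa>: "0 < \<kappa>"
    and step: "\<forall>\<^sub>F k in sequentially. E (Suc k) \<le> E k - \<kappa> / real k * E k + D k / real k"
    and D: "D \<longlonglongrightarrow> 0" and \<epsilon>: "0 < \<epsilon>"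
  shows "\<forall>\<^sub>F k in sequentially. E k \<le> \<epsilon>"
proof -
  have "\<forall>\<^sub>F k in sequentially. D k < \<kappa> * \<epsilon> / 2"
    by (rule order_tendstoD[OF D]) (use \<kappa> \<epsilon> in simp)
  with step have "\<forall>\<^sub>F k in sequentially. D k < \<kappa> * \<epsilon> / 2 \<and> \<kappa> \<le> real k \<and> 0 < k \<and>
      E (Suc k) \<le> E k - \<kappa> / real k * E k + D k / real k"
    by (intro eventually_conj eventually_gt_at_top
        eventually_compose_filterlim[OF eventually_ge_at_top filterlim_real_sequentially])
  then obtain N where N: "\<And>k. N \<le> k \<Longrightarrow> D k < \<kappa> * \<epsilon> / 2" "\<And>k. N \<le> k \<Longrightarrow> \<kappa> \<le> real k" "\<And>k. N \<le> k \<Longrightarrow> 0 < k"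
      "\<And>k. N \<le> k \<Longrightarrow> E (Suc k) \<le> E k - \<kappa> / real k * E k + D k / real k"
    unfolding eventually_sequentially by metis
  have N': "E (Suc k) \<le> E k - \<kappa> / real k * E k + (\<kappa> * \<epsilon> / 2) / real k" if "N \<le> k" for k
    using N(4)[OF that] divide_right_mono[of "D k" "\<kappa> * \<epsilon> / 2" "real k"] N(1)[OF that] by linarith
  have "\<exists>k\<ge>N. E k \<le> \<epsilon>"
  proof (rule ccontr)
    assume "\<not> (\<exists>k\<ge>N. E k \<le> \<epsilon>)"
    then have big: "\<epsilon> < E k" if "N \<le> k" for k using that by force
    have le: "(\<kappa> * \<epsilon> / 2) * inverse (real k) \<le> E k - E (Suc k)" if "N \<le> k" for k
    proof -
      have "\<kappa> / real k * \<epsilon> \<le> \<kappa> / real k * E k"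
        using big[OF that] \<kappa> by (intro mult_left_mono) auto
      then show ?thesis using N'[OF that] by (simp add: field_simps)
    qed
    have "(\<kappa> * \<epsilon> / 2) * (\<Sum>k=N..<n. inverse (real k)) \<le> E N" if "N \<le> n" for n
    proof -
      have "(\<Sum>k=N..<n. (\<kappa> * \<epsilon> / 2) * inverse (real k)) \<le> (\<Sum>k=N..<n. E k - E (Suc k))"
        by (rule sum_mono) (use le in auto)
      also have "\<dots> = E N - E n"
        using sum_Suc_diff'[of N n "\<lambda>k. - E k"] that by simp
      finally show ?thesis using big[OF that] \<epsilon> by (simp add: sum_distrib_left)
    qed
    note bound = this
    have "summable (\<lambda>n. inverse (real (n + N)))"
    proof (rule summableI_nonneg_bounded)
      show "(\<Sum>i<n. inverse (real (i + N))) \<le> E N / (\<kappa> * \<epsilon> / 2)" for n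
      proof -
        have "(\<Sum>i<n. inverse (real (i + N))) = (\<Sum>k=N..<N + n. inverse (real k))"
          using sum.shift_bounds_nat_ivl[of "\<lambda>k. inverse (real k)" 0 N n]
          by (simp add: lessThan_atLeast0 add.commute)
        then show ?thesis using bound[of "N + n"] \<kappa> \<epsilon> by (simp add: field_simps)
      qed
    qed simp
    then have "summable (\<lambda>n. inverse (real n))" using summable_iff_shift[of "\<lambda>n. inverse (real n)" N] by blast
    then show False using not_summable_harmonic[where 'a=real] by (simp add: inverse_eq_divide)
  qed
  then obtain k0 where k0: "N \<le> k0" "E k0 \<le> \<epsilon>" by blast
  have "E k \<le> \<epsilon>" if "k0 \<le> k" for k
  proof -
    have "E k \<le> max (E k0) ((\<kappa> * \<epsilon> / 2) / \<kappa>)"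
      by (rule contraction_bounded[OF \<kappa>]) (use N N' k0 that in auto)
    then show ?thesis using k0 \<kappa> \<epsilon> by (simp add: max_def split: if_splits)
  qed
  then show ?thesis by (auto simp: eventually_sequentially)
qed

section \<open>The energy of the inertial iteration\<close>

lemma norm_square_scaleR_add:
  fixes u w :: "'a::real_inner"
  shows "(norm (s *\<^sub>R u + t *\<^sub>R w))\<^sup>2
    = s\<^sup>2 * (norm u)\<^sup>2 + 2 * (s * t) * (u \<bullet> w) + t\<^sup>2 * (norm w)\<^sup>2"
  unfolding power2_norm_eq_inner
  by (simp add: inner_add_left inner_add_right inner_commute power2_eq_square)

text \<open>
  The iteration reduced to what the energy argument uses: \<open>\<phi> k\<close> and \<open>g k\<close> are the value and the
  gradient at \<open>x k\<close> of a convex function with minimum \<open>0\<close>, attained at \<open>z\<close>.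
\<close>

locale tikhonov_inertial =
  fixes x g :: "nat \<Rightarrow> 'a::real_inner" and \<phi> :: "nat \<Rightarrow> real" and z :: 'a and \<alpha> c :: real
  assumes \<alpha>: "3 < \<alpha>" and c: "0 < c"
    and rec: "\<And>k. 1 \<le> k \<Longrightarrow> x (Suc k) - x k
        = (1 - \<alpha> / real k) *\<^sub>R (x k - x (k - 1)) - g (Suc k) - (c / (real k)\<^sup>2) *\<^sub>R x k"
    and grad_step: "\<And>k. 1 \<le> k \<Longrightarrow> g (Suc k) \<bullet> (x k - x (Suc k)) \<le> \<phi> k - \<phi> (Suc k)"
    and grad_z: "\<And>k. 1 \<le> k \<Longrightarrow> \<phi> (Suc k) \<le> g (Suc k) \<bullet> (x (Suc k) - z)"
    and \<phi>_nonneg: "\<And>k. 0 \<le> \<phi> k"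
begin

text \<open>
  The midpoint of the admissible interval from \<open>2\<close> to \<open>\<alpha> - 1\<close>; then \<open>b - 2\<close> and \<open>\<alpha> - 1 - b\<close> are
  both equal to \<open>r\<close>.
\<close>

definition "b = (\<alpha> + 1) / 2"
definition "r = (\<alpha> - 3) / 2"
definition "d k = x k - x (k - 1)"
text \<open>
  The discrete counterpart of \<open>b (x - z) + t x'\<close>.  Anchoring it at \<open>x (k - 1)\<close> with weight \<open>k - 1\<close>
  makes the increments in \<open>v_diff\<close> exact, with no remainder of lower order.
\<close>

definition "v k = b *\<^sub>R (x (k - 1) - z) + (real k - 1) *\<^sub>R d k"
definition "E k = (real k - 1)\<^sup>2 * \<phi> k + (norm (v k))\<^sup>2 / 2
   + r * b / 2 * (norm (x (k - 1) - z))\<^sup>2 + c / 2 * ((norm (x k))\<^sup>2 - (norm z)\<^sup>2)"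

lemma parameter_relations: "2 < b" "0 < r" "b = r + 2" "\<alpha> = r + b + 1"
  using \<alpha> by (auto simp: b_def r_def field_simps)

lemma x_decomp: "x k = x (k - 1) + d k" "x (Suc k) = x k + d (Suc k)"
  by (auto simp: d_def)

lemma v_Suc: "v (Suc k) = b *\<^sub>R (x k - z) + real k *\<^sub>R d (Suc k)"
  by (simp add: v_def)

lemma scaled_gradient_eq:
  assumes "1 \<le> k"
  shows "real k *\<^sub>R g (Suc k)
    = (real k - \<alpha>) *\<^sub>R d k - real k *\<^sub>R d (Suc k) - (c / real k) *\<^sub>R x k"
proof -
  have "g (Suc k) = (1 - \<alpha> / real k) *\<^sub>R d k - d (Suc k) - (c / (real k)\<^sup>2) *\<^sub>R x k"
    using rec[OF assms] by (simp add: d_def algebra_simps)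
  then have "real k *\<^sub>R g (Suc k) = (real k * (1 - \<alpha> / real k)) *\<^sub>R d k - real k *\<^sub>R d (Suc k)
      - (real k * (c / (real k)\<^sup>2)) *\<^sub>R x k"
    by (simp add: scaleR_diff_right)
  moreover have "real k * (1 - \<alpha> / real k) = real k - \<alpha>" "real k * (c / (real k)\<^sup>2) = c / real k"
    using assms by (auto simp: field_simps power2_eq_square)
  ultimately show ?thesis by simp
qed

lemma v_diff:
  assumes "1 \<le> k"
  shows "v (Suc k) - v k = - r *\<^sub>R d k - real k *\<^sub>R g (Suc k) - (c / real k) *\<^sub>R x k"
    and "v (Suc k) - v k = real k *\<^sub>R (d (Suc k) - d k) + (b + 1) *\<^sub>R d k"
proof -
  show *: "v (Suc k) - v k = real k *\<^sub>R (d (Suc k) - d k) + (b + 1) *\<^sub>R d k"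
    unfolding v_Suc by (simp add: v_def x_decomp(1)[of k] algebra_simps)
  show "v (Suc k) - v k = - r *\<^sub>R d k - real k *\<^sub>R g (Suc k) - (c / real k) *\<^sub>R x k"
  proof -
    have "(b + 1) *\<^sub>R d k = \<alpha> *\<^sub>R d k - r *\<^sub>R d k"
      using parameter_relations(4) by (simp flip: scaleR_diff_left)
    with * show ?thesis
      unfolding scaled_gradient_eq[OF assms] by (simp add: scaleR_diff_left scaleR_diff_right)
  qed
qed

text \<open>
  The only inequalities used are the two convexity estimates: the one towards \<open>z\<close> with weight
  \<open>k b\<close>, the one between consecutive iterates with weight \<open>k\<^sup>2 - k b\<close>, which is where \<open>b \<le> k\<close> enters.
  Together they turn \<open>(k - 1)\<^sup>2 \<phi> k\<close> into \<open>k\<^sup>2 \<phi> (Suc k)\<close> at a gain of \<open>((b - 2) k + 1) \<phi> k\<close>.  The square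
  of \<open>v (Suc k) - v k\<close> is the numerical dissipation of an implicit scheme.
\<close>

lemma E_step_basic:
  assumes k: "1 \<le> k" "b \<le> real k"
  shows "E (Suc k) - E k \<le> - r * real k * \<phi> k
      - r * real k * (d (Suc k) \<bullet> d k)
      - b * c / (2 * real k) * ((norm (x k))\<^sup>2 - (norm z)\<^sup>2 + (norm (x k - z))\<^sup>2)
      + c / 2 * (norm (d (Suc k)))\<^sup>2 - (norm (v (Suc k) - v k))\<^sup>2 / 2"
proof -
  define g' where "g' = g (Suc k)"
  define e where "e = d (Suc k)"
  define t where "t = real k"
  have t: "0 < t" "b \<le> t" using k by (auto simp: t_def)
  \<comment> \<open>Increments of the quadratic terms of the energy.\<close>
  have v2: "(norm (v (Suc k)))\<^sup>2 / 2 - (norm (v k))\<^sup>2 / 2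
      = v (Suc k) \<bullet> (v (Suc k) - v k) - (norm (v (Suc k) - v k))\<^sup>2 / 2"
    by (simp add: power2_norm_eq_inner inner_diff_left inner_diff_right inner_commute field_simps)
  have vd: "v (Suc k) \<bullet> (v (Suc k) - v k) = - r * b * ((x k - z) \<bullet> d k) - r * t * (e \<bullet> d k)
      - t * b * ((x k - z) \<bullet> g') - t\<^sup>2 * (e \<bullet> g')
      - b * c / t * ((x k - z) \<bullet> x k) - c * (e \<bullet> x k)"
    unfolding v_diff(1)[OF k(1)] unfolding v_Suc g'_def[symmetric] e_def[symmetric] t_def[symmetric]
    using t by (simp add: inner_add_left inner_diff_right power2_eq_square) (simp add: field_simps)
  have xz: "(norm (x k - z))\<^sup>2 - (norm (x (k - 1) - z))\<^sup>2 = 2 * ((x k - z) \<bullet> d k) - (norm (d k))\<^sup>2"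
    by (simp add: d_def power2_norm_eq_inner algebra_simps inner_commute)
  have xx: "(norm (x (Suc k)))\<^sup>2 - (norm (x k))\<^sup>2 = 2 * (e \<bullet> x k) + (norm e)\<^sup>2"
    by (simp add: x_decomp(2) e_def power2_norm_eq_inner algebra_simps inner_commute)
  have xzx: "(norm (x k))\<^sup>2 - (norm z)\<^sup>2 + (norm (x k - z))\<^sup>2 = 2 * ((x k - z) \<bullet> x k)"
    by (simp add: power2_norm_eq_inner algebra_simps inner_commute)
  have "\<phi> (Suc k) \<le> (x k - z) \<bullet> g' + e \<bullet> g'"
    using grad_z[OF k(1)] by (simp add: g'_def e_def x_decomp(2) algebra_simps inner_commute)
  then have 1: "t * b * \<phi> (Suc k) \<le> t * b * ((x k - z) \<bullet> g') + t * b * (e \<bullet> g')"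
    using t parameter_relations by (simp flip: distrib_left)
  have "- (e \<bullet> g') \<le> \<phi> k - \<phi> (Suc k)"
    using grad_step[OF k(1)] by (simp add: g'_def e_def x_decomp(2) inner_commute)
  then have "(t\<^sup>2 - t * b) * (- (e \<bullet> g')) \<le> (t\<^sup>2 - t * b) * (\<phi> k - \<phi> (Suc k))"
    using t by (intro mult_left_mono) (auto simp: power2_eq_square)
  then have 2: "- t * b * ((x k - z) \<bullet> g') - t\<^sup>2 * (e \<bullet> g') \<le> (t\<^sup>2 - t * b) * \<phi> k - t\<^sup>2 * \<phi> (Suc k)"
    using 1 by (simp add: algebra_simps)
  have 3: "(t\<^sup>2 - t * b) * \<phi> k - (t - 1)\<^sup>2 * \<phi> k = - r * t * \<phi> k - \<phi> k"
    using parameter_relations(3) by (simp add: algebra_simps power2_eq_square)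
  have 4: "0 \<le> r * b / 2 * (norm (d k))\<^sup>2" using parameter_relations by simp
  have 5: "b * c / (2 * t) * ((norm (x k))\<^sup>2 - (norm z)\<^sup>2 + (norm (x k - z))\<^sup>2)
      = b * c / t * ((x k - z) \<bullet> x k)"
    unfolding xzx by simp
  have "E (Suc k) - E k = t\<^sup>2 * \<phi> (Suc k) - (t - 1)\<^sup>2 * \<phi> k
      + ((norm (v (Suc k)))\<^sup>2 / 2 - (norm (v k))\<^sup>2 / 2)
      + r * b / 2 * ((norm (x k - z))\<^sup>2 - (norm (x (k - 1) - z))\<^sup>2)
      + c / 2 * ((norm (x (Suc k)))\<^sup>2 - (norm (x k))\<^sup>2)"
    by (simp add: E_def t_def algebra_simps)
  also have "\<dots> = t\<^sup>2 * \<phi> (Suc k) - (t - 1)\<^sup>2 * \<phi> k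
      + (- t * b * ((x k - z) \<bullet> g') - t\<^sup>2 * (e \<bullet> g')) - r * t * (e \<bullet> d k)
      - b * c / t * ((x k - z) \<bullet> x k) - (norm (v (Suc k) - v k))\<^sup>2 / 2
      - r * b / 2 * (norm (d k))\<^sup>2 + c / 2 * (norm e)\<^sup>2"
    unfolding v2 vd xz xx by (simp add: algebra_simps)
  finally show ?thesis
    using 2 3 4 5 \<phi>_nonneg[of k] unfolding e_def[symmetric] t_def[symmetric] by linarith
qed

text \<open>
  With \<open>w = d (Suc k) - d k\<close>, all mixed terms combine to \<open>(r + b + 1) k (w \<bullet> d k)\<close>.  Young's inequality
  pays for it with half of the numerical dissipation \<open>k\<^sup>2 |w|\<^sup>2 / 2\<close> and with a bounded multiple of
  \<open>|d k|\<^sup>2\<close>, which the friction term \<open>r k |d k|\<^sup>2\<close> absorbs for large \<open>k\<close>.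
\<close>

lemma dissipation:
  "\<forall>\<^sub>F k in sequentially.
     - r * real k * (d (Suc k) \<bullet> d k) + c / 2 * (norm (d (Suc k)))\<^sup>2 - (norm (v (Suc k) - v k))\<^sup>2 / 2
     \<le> - (r / 2) * real k * (norm (d k))\<^sup>2 - (real k)\<^sup>2 / 8 * (norm (d (Suc k) - d k))\<^sup>2"
proof -
  define B where "B = r + b + 1"
  have "\<forall>\<^sub>F k in sequentially. 1 \<le> k \<and> 8 * c \<le> real k \<and> (B\<^sup>2 + c) * 2 / r \<le> real k"
    by (intro eventually_conj eventually_ge_at_top
        eventually_compose_filterlim[OF eventually_ge_at_top filterlim_real_sequentially])
  then show ?thesis
  proof eventually_elim
    case (elim k)
    define t where "t = real k"
    define w where "w = d (Suc k) - d k"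
    have t: "1 \<le> t" "8 * c \<le> t" "B\<^sup>2 + c \<le> r / 2 * t"
      using elim parameter_relations by (auto simp: t_def field_simps)
    have ds: "d (Suc k) = d k + w" by (simp add: w_def)
    have V: "(norm (v (Suc k) - v k))\<^sup>2
        = t\<^sup>2 * (norm w)\<^sup>2 + 2 * (b + 1) * t * (w \<bullet> d k) + (b + 1)\<^sup>2 * (norm (d k))\<^sup>2"
      unfolding v_diff(2)[of k, OF conjunct1[OF elim]] w_def[symmetric] t_def[symmetric]
      by (simp add: norm_square_scaleR_add)
    have dd: "d (Suc k) \<bullet> d k = (norm (d k))\<^sup>2 + w \<bullet> d k"
      by (simp add: ds power2_norm_eq_inner inner_add_left)
    have "0 \<le> (norm ((t / 2) *\<^sub>R w + B *\<^sub>R d k))\<^sup>2" by simp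
    also have "\<dots> = t\<^sup>2 / 4 * (norm w)\<^sup>2 + B * t * (w \<bullet> d k) + B\<^sup>2 * (norm (d k))\<^sup>2"
      by (simp add: norm_square_scaleR_add power_divide)
    finally have 1: "- (B * t * (w \<bullet> d k)) \<le> t\<^sup>2 / 4 * (norm w)\<^sup>2 + B\<^sup>2 * (norm (d k))\<^sup>2" by simp
    have "0 \<le> (norm (d k - w))\<^sup>2" by simp
    then have "(norm (d (Suc k)))\<^sup>2 \<le> 2 * (norm (d k))\<^sup>2 + 2 * (norm w)\<^sup>2"
      by (simp add: ds power2_norm_eq_inner algebra_simps inner_commute)
    then have 2: "c / 2 * (norm (d (Suc k)))\<^sup>2 \<le> c * (norm (d k))\<^sup>2 + c * (norm w)\<^sup>2"
      using mult_left_mono[of "(norm (d (Suc k)))\<^sup>2" "2 * (norm (d k))\<^sup>2 + 2 * (norm w)\<^sup>2" "c / 2"] c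
      by (simp add: algebra_simps)
    have "8 * c \<le> t\<^sup>2" using t mult_left_mono[of 1 t t] unfolding power2_eq_square by linarith
    then have 3: "c * (norm w)\<^sup>2 \<le> t\<^sup>2 / 8 * (norm w)\<^sup>2" by (intro mult_right_mono) auto
    have 4: "(B\<^sup>2 + c) * (norm (d k))\<^sup>2 \<le> r / 2 * t * (norm (d k))\<^sup>2"
      using t by (intro mult_right_mono) auto
    have 5: "0 \<le> (b + 1)\<^sup>2 * (norm (d k))\<^sup>2" by simp
    define R Q where "R = r * t * (norm (d k))\<^sup>2" and "Q = t\<^sup>2 * (norm w)\<^sup>2"
    have 6: "- r * t * (d (Suc k) \<bullet> d k) - (norm (v (Suc k) - v k))\<^sup>2 / 2
        = - R - B * t * (w \<bullet> d k) - Q / 2 - ((b + 1)\<^sup>2 * (norm (d k))\<^sup>2) / 2"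
      unfolding V dd R_def Q_def B_def by (simp add: field_simps)
    have 7: "- (r / 2) * t * (norm (d k))\<^sup>2 - t\<^sup>2 / 8 * (norm w)\<^sup>2 = - R / 2 - Q / 8"
      by (simp add: R_def Q_def)
    have 8: "c * (norm w)\<^sup>2 \<le> Q / 8" "B\<^sup>2 * (norm (d k))\<^sup>2 + c * (norm (d k))\<^sup>2 \<le> R / 2"
        "- (B * t * (w \<bullet> d k)) \<le> Q / 4 + B\<^sup>2 * (norm (d k))\<^sup>2"
      using 1 3 4 by (simp_all add: R_def Q_def distrib_right)
    show ?case
      unfolding w_def[symmetric] t_def[symmetric] using 2 5 6 7 8 by linarith
  qed
qed

text \<open>
  \<open>P\<close> bounds the contribution of \<open>|x k - z|\<^sup>2\<close> to the energy; the rate \<open>\<kappa>\<close> is chosen so small that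
  \<open>\<kappa> / k\<close> times the energy is absorbed, term by term, by the losses in \<open>E_step_basic\<close> and
  \<open>dissipation\<close>.
\<close>

definition "P = 2 * b\<^sup>2 + r * b"
definition "\<kappa> = min r (min (b * c / (2 * P)) (r / (2 * (P + 1))))"

lemma P_pos: "0 < P" using parameter_relations by (simp add: P_def add_pos_pos)

lemma \<kappa>_bounds: "0 < \<kappa>" "\<kappa> \<le> r" "\<kappa> \<le> b" "\<kappa> * P \<le> b * c / 2" "\<kappa> * (P + 1) \<le> r / 2"
proof -
  show "0 < \<kappa>" using parameter_relations c P_pos by (simp add: \<kappa>_def)
  show *: "\<kappa> \<le> r" by (simp add: \<kappa>_def)
  show "\<kappa> \<le> b" using * parameter_relations by simp
  have "\<kappa> \<le> b * c / (2 * P)" by (simp add: \<kappa>_def)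
  then show "\<kappa> * P \<le> b * c / 2" using P_pos by (simp add: field_simps)
  have "\<kappa> \<le> r / (2 * (P + 1))" by (simp add: \<kappa>_def)
  then show "\<kappa> * (P + 1) \<le> r / 2" using P_pos by (simp add: field_simps)
qed

lemma E_le:
  assumes k: "1 \<le> k"
  shows "\<kappa> / real k * E k \<le> r * real k * \<phi> k + b * c / (2 * real k) * (norm (x k - z))\<^sup>2
    + r / 2 * real k * (norm (d k))\<^sup>2 + \<kappa> * c / (2 * real k) * ((norm (x k))\<^sup>2 - (norm z)\<^sup>2)"
proof -
  define t where "t = real k"
  define A where "A = (norm (x (k - 1) - z))\<^sup>2"
  define X where "X = (norm (x k - z))\<^sup>2"
  define D where "D = (norm (d k))\<^sup>2"
  have t: "1 \<le> t" using k by (simp add: t_def)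
  have nn: "0 \<le> X" "0 \<le> D" by (auto simp: X_def D_def)
  have "x (k - 1) - z = 1 *\<^sub>R (x k - z) + (-1) *\<^sub>R d k" by (simp add: d_def)
  then have "A = X - 2 * ((x k - z) \<bullet> d k) + D"
    unfolding A_def X_def D_def by (simp only: norm_square_scaleR_add) simp
  moreover have "0 \<le> (norm (1 *\<^sub>R (x k - z) + 1 *\<^sub>R d k))\<^sup>2" by simp
  then have "0 \<le> X + 2 * ((x k - z) \<bullet> d k) + D"
    unfolding X_def D_def by (simp only: norm_square_scaleR_add) simp
  ultimately have A: "A \<le> 2 * X + 2 * D" by simp
  have "0 \<le> (norm (b *\<^sub>R (x (k - 1) - z) + (- (t - 1)) *\<^sub>R d k))\<^sup>2" by simp
  then have "2 * (b * (t - 1)) * ((x (k - 1) - z) \<bullet> d k) \<le> b\<^sup>2 * A + (t - 1)\<^sup>2 * D"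
    unfolding A_def D_def norm_square_scaleR_add power2_minus mult_minus_right mult_minus_left by linarith
  then have "(norm (v k))\<^sup>2 / 2 \<le> b\<^sup>2 * A + (t - 1)\<^sup>2 * D"
    unfolding v_def A_def D_def t_def[symmetric] norm_square_scaleR_add by simp
  moreover have "(t - 1)\<^sup>2 \<le> t\<^sup>2" using t by (intro power_mono) auto
  then have "(t - 1)\<^sup>2 * D \<le> t\<^sup>2 * D" "(t - 1)\<^sup>2 * \<phi> k \<le> t\<^sup>2 * \<phi> k"
    using nn \<phi>_nonneg by (auto intro: mult_right_mono)
  moreover have "(b\<^sup>2 + r * b / 2) * A \<le> (b\<^sup>2 + r * b / 2) * (2 * X + 2 * D)"
    using A parameter_relations by (intro mult_left_mono) auto
  ultimately have E: "E k \<le> t\<^sup>2 * \<phi> k + P * X + P * D + t\<^sup>2 * D + c / 2 * ((norm (x k))\<^sup>2 - (norm z)\<^sup>2)"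
    unfolding E_def A_def[symmetric] t_def[symmetric] P_def by (simp add: algebra_simps)
  have "P * D \<le> P * D * t\<^sup>2" using t nn P_pos mult_left_mono[of 1 "t\<^sup>2" "P * D"] by simp
  with E have E: "E k \<le> t\<^sup>2 * \<phi> k + P * X + (P + 1) * t\<^sup>2 * D + c / 2 * ((norm (x k))\<^sup>2 - (norm z)\<^sup>2)"
    by (simp add: algebra_simps)
  have "\<kappa> / t * E k \<le> \<kappa> / t * (t\<^sup>2 * \<phi> k + P * X + (P + 1) * t\<^sup>2 * D + c / 2 * ((norm (x k))\<^sup>2 - (norm z)\<^sup>2))"
    using E \<kappa>_bounds(1) t by (intro mult_left_mono) auto
  also have "\<dots> = \<kappa> * (t * \<phi> k) + \<kappa> * P * (X / t) + \<kappa> * (P + 1) * (t * D)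
      + \<kappa> * c / (2 * t) * ((norm (x k))\<^sup>2 - (norm z)\<^sup>2)"
    using t by (simp add: field_simps power2_eq_square)
  also have "\<dots> \<le> r * (t * \<phi> k) + b * c / 2 * (X / t) + r / 2 * (t * D)
      + \<kappa> * c / (2 * t) * ((norm (x k))\<^sup>2 - (norm z)\<^sup>2)"
    using \<kappa>_bounds t nn \<phi>_nonneg[of k] by (intro add_mono mult_right_mono order_refl) auto
  finally show ?thesis by (simp add: t_def X_def D_def mult.assoc)
qed

definition "\<delta> k = max 0 ((norm z)\<^sup>2 - (norm (x k))\<^sup>2)"

text \<open>
  What the losses do not absorb is a multiple of \<open>|z|\<^sup>2 - |x k|\<^sup>2\<close>, because \<open>x k \<bullet> (x k - z)\<close> can be
  negative; this happens only while \<open>x k\<close> is closer to the origin than \<open>z\<close>.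
\<close>

lemma E_step:
  "\<forall>\<^sub>F k in sequentially. E (Suc k) \<le> E k - \<kappa> / real k * E k + b * c / 2 * \<delta> k / real k
      - (real k)\<^sup>2 / 8 * (norm (d (Suc k) - d k))\<^sup>2"
proof -
  have "\<forall>\<^sub>F k in sequentially. 1 \<le> k \<and> b \<le> real k"
    by (intro eventually_conj eventually_ge_at_top
        eventually_compose_filterlim[OF eventually_ge_at_top filterlim_real_sequentially])
  with dissipation show ?thesis
  proof eventually_elim
    case (elim k)
    have "(b - \<kappa>) * c / (2 * real k) * ((norm z)\<^sup>2 - (norm (x k))\<^sup>2) \<le> (b - \<kappa>) * c / (2 * real k) * \<delta> k"
      using \<kappa>_bounds c by (intro mult_left_mono) (auto simp: \<delta>_def)
    also have "\<dots> \<le> b * c / (2 * real k) * \<delta> k"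
      using \<kappa>_bounds c by (intro mult_right_mono divide_right_mono) (auto simp: \<delta>_def)
    also have "\<dots> = b * c / 2 * \<delta> k / real k" by simp
    finally have 1: "(b - \<kappa>) * c / (2 * real k) * ((norm z)\<^sup>2 - (norm (x k))\<^sup>2) \<le> b * c / 2 * \<delta> k / real k" .
    have 2: "(b - \<kappa>) * c / (2 * real k) * ((norm z)\<^sup>2 - (norm (x k))\<^sup>2)
       = \<kappa> * c / (2 * real k) * ((norm (x k))\<^sup>2 - (norm z)\<^sup>2) - b * c / (2 * real k) * ((norm (x k))\<^sup>2 - (norm z)\<^sup>2)"
      by (simp add: algebra_simps add_divide_distrib diff_divide_distrib)
    have 3: "b * c / (2 * real k) * ((norm (x k))\<^sup>2 - (norm z)\<^sup>2 + (norm (x k - z))\<^sup>2)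
       = b * c / (2 * real k) * ((norm (x k))\<^sup>2 - (norm z)\<^sup>2) + b * c / (2 * real k) * (norm (x k - z))\<^sup>2"
      by (rule distrib_left)
    show ?case
      using E_step_basic[of k] E_le[of k] elim 1 2 3 by linarith
  qed
qed

lemma \<delta>_bounds: "0 \<le> \<delta> k" "\<delta> k \<le> (norm z)\<^sup>2"
  by (auto simp: \<delta>_def)

text \<open>
  The only term of the energy that may be negative is compensated by \<open>c / 2 * \<delta> k\<close>, so each of the
  remaining nonnegative terms is controlled separately.
\<close>

lemma E_lower:
  shows "(real k - 1)\<^sup>2 * \<phi> k \<le> E k + c / 2 * \<delta> k"
    and "(norm (v k))\<^sup>2 / 2 \<le> E k + c / 2 * \<delta> k"
    and "r * b / 2 * (norm (x (k - 1) - z))\<^sup>2 \<le> E k + c / 2 * \<delta> k"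
proof -
  have 1: "0 \<le> (real k - 1)\<^sup>2 * \<phi> k" using \<phi>_nonneg by simp
  have 2: "0 \<le> (norm (v k))\<^sup>2 / 2" "0 \<le> r * b / 2 * (norm (x (k - 1) - z))\<^sup>2" using parameter_relations by auto
  have "c / 2 * ((norm z)\<^sup>2 - (norm (x k))\<^sup>2) \<le> c / 2 * \<delta> k"
    using c by (intro mult_left_mono) (auto simp: \<delta>_def)
  then have 3: "0 \<le> c / 2 * ((norm (x k))\<^sup>2 - (norm z)\<^sup>2) + c / 2 * \<delta> k"
    by (simp add: algebra_simps)
  show "(real k - 1)\<^sup>2 * \<phi> k \<le> E k + c / 2 * \<delta> k"
    and "(norm (v k))\<^sup>2 / 2 \<le> E k + c / 2 * \<delta> k"
    and "r * b / 2 * (norm (x (k - 1) - z))\<^sup>2 \<le> E k + c / 2 * \<delta> k"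
    using 1 2 3 unfolding E_def by linarith+
qed

lemma E_bounded: "\<exists>M. \<forall>\<^sub>F k in sequentially. \<bar>E k\<bar> \<le> M"
proof -
  have "\<forall>\<^sub>F k in sequentially. 0 < k \<and> \<kappa> \<le> real k \<and>
      E (Suc k) \<le> E k - \<kappa> / real k * E k + b * c / 2 * (norm z)\<^sup>2 / real k"
  proof -
    have "\<forall>\<^sub>F k in sequentially. 0 < k \<and> \<kappa> \<le> real k"
      by (intro eventually_conj eventually_gt_at_top
        eventually_compose_filterlim[OF eventually_ge_at_top filterlim_real_sequentially])
    with E_step show ?thesis
    proof eventually_elim
      case (elim k)
      have "b * c / 2 * \<delta> k / real k \<le> b * c / 2 * (norm z)\<^sup>2 / real k"
        using \<delta>_bounds parameter_relations c by (intro divide_right_mono mult_left_mono) auto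
      moreover have "0 \<le> (real k)\<^sup>2 / 8 * (norm (d (Suc k) - d k))\<^sup>2" by simp
      ultimately show ?case using elim by linarith
    qed
  qed
  then obtain K where K: "\<And>k. K \<le> k \<Longrightarrow> 0 < k" "\<And>k. K \<le> k \<Longrightarrow> \<kappa> \<le> real k"
      "\<And>k. K \<le> k \<Longrightarrow> E (Suc k) \<le> E k - \<kappa> / real k * E k + b * c / 2 * (norm z)\<^sup>2 / real k"
    unfolding eventually_sequentially by metis
  define U where "U = max (E K) (b * c / 2 * (norm z)\<^sup>2 / \<kappa>)"
  have "E k \<le> U" if "K \<le> k" for k
    unfolding U_def by (rule contraction_bounded[OF \<kappa>_bounds(1)]) (use K that in auto)
  moreover have "- (c / 2 * (norm z)\<^sup>2) \<le> E k" for k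
  proof -
    have "0 \<le> E k + c / 2 * \<delta> k"
      using E_lower(2)[of k] zero_le_power2[of "norm (v k)"] by linarith
    moreover have "c / 2 * \<delta> k \<le> c / 2 * (norm z)\<^sup>2" using \<delta>_bounds c by (intro mult_left_mono) auto
    ultimately show ?thesis by linarith
  qed
  ultimately have "\<bar>E k\<bar> \<le> max U (c / 2 * (norm z)\<^sup>2)" if "K \<le> k" for k
    using that unfolding abs_le_iff by (meson le_max_iff_disj minus_le_iff)
  then show ?thesis by (auto simp: eventually_sequentially)
qed

lemma E_plus_bounded: "\<exists>M\<ge>0. \<forall>\<^sub>F k in sequentially. E k + c / 2 * \<delta> k \<le> M"
proof -
  obtain M where "\<forall>\<^sub>F k in sequentially. \<bar>E k\<bar> \<le> M" using E_bounded by blast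
  then have "\<forall>\<^sub>F k in sequentially. E k + c / 2 * \<delta> k \<le> \<bar>M\<bar> + c / 2 * (norm z)\<^sup>2"
  proof eventually_elim
    case (elim k)
    have "c / 2 * \<delta> k \<le> c / 2 * (norm z)\<^sup>2" using \<delta>_bounds c by (intro mult_left_mono) auto
    then show ?case using elim by linarith
  qed
  moreover have "0 \<le> \<bar>M\<bar> + c / 2 * (norm z)\<^sup>2" using c by simp
  ultimately show ?thesis by blast
qed

lemma \<phi>_tendsto_0: "\<phi> \<longlonglongrightarrow> 0"
proof -
  obtain M where M: "\<forall>\<^sub>F k in sequentially. E k + c / 2 * \<delta> k \<le> M" using E_plus_bounded by blast
  show ?thesis
  proof (rule tendsto_sandwich)
    show "\<forall>\<^sub>F k in sequentially. 0 \<le> \<phi> k" using \<phi>_nonneg by simp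
    show "\<forall>\<^sub>F k in sequentially. \<phi> k \<le> M / (real k - 1)\<^sup>2"
      using M eventually_gt_at_top[of 1]
    proof eventually_elim
      case (elim k)
      then show ?case using E_lower(1)[of k] by (simp add: field_simps)
    qed
    show "(\<lambda>k. M / (real k - 1)\<^sup>2) \<longlonglongrightarrow> 0" by real_asymp
  qed auto
qed

text \<open>
  Bounded energy gives \<open>k\<^sup>2/8 |d (Suc k) - d k|\<^sup>2 \<le> E k - E (Suc k) + C/k\<close>.  Multiplied by the decreasing
  weight \<open>k powr (2s - 2)\<close> the differences of \<open>E + M \<ge> 0\<close> telescope and the error becomes the
  summable \<open>C k powr (2s - 3)\<close>.
\<close>

lemma weighted_acceleration_summable:
  assumes s: "s < 1"
  shows "summable (\<lambda>k. real k powr (2 * s) * (norm (d (Suc k) - d k))\<^sup>2)"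
proof -
  obtain M where M: "\<forall>\<^sub>F k in sequentially. \<bar>E k\<bar> \<le> M" using E_bounded by blast
  define C where "C = \<kappa> * M + b * c / 2 * (norm z)\<^sup>2"
  define G where "G k = real k powr (2 * s - 2) * (E k + M)" for k
  have "G \<longlonglongrightarrow> 0"
  proof (rule tendsto_sandwich)
    show "\<forall>\<^sub>F k in sequentially. 0 \<le> G k"
      using M by eventually_elim (simp add: G_def)
    show "\<forall>\<^sub>F k in sequentially. G k \<le> real k powr (2 * s - 2) * (2 * M)"
      using M by eventually_elim (auto simp: G_def intro!: mult_left_mono)
    show "(\<lambda>k. real k powr (2 * s - 2) * (2 * M)) \<longlonglongrightarrow> 0"
      by (intro tendsto_mult_left_zero tendsto_neg_powr filterlim_real_sequentially) (use s in simp)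
  qed auto
  then have "summable (\<lambda>k. G k - G (Suc k))" by (rule telescope_summable')
  moreover have "summable (\<lambda>k. C * real k powr (2 * s - 3))"
    using s by (intro summable_mult) (simp add: summable_real_powr_iff)
  ultimately have sum: "summable (\<lambda>k. 8 * ((G k - G (Suc k)) + C * real k powr (2 * s - 3)))"
    by (rule summable_mult[OF summable_add])
  have M': "\<forall>\<^sub>F k in sequentially. \<bar>E (Suc k)\<bar> \<le> M"
    using M by (subst eventually_sequentially_Suc)
  have "\<forall>\<^sub>F k in sequentially. norm (real k powr (2 * s) * (norm (d (Suc k) - d k))\<^sup>2)
      \<le> 8 * ((G k - G (Suc k)) + C * real k powr (2 * s - 3))"
    using E_step M M' eventually_gt_at_top[of 0]
  proof eventually_elim
    case (elim k)
    define q where "q = (norm (d (Suc k) - d k))\<^sup>2"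
    define \<beta> where "\<beta> = real k powr (2 * s - 2)"
    have k: "0 < real k" using elim by simp
    have "\<kappa> / real k * (- E k) \<le> \<kappa> / real k * M"
      using elim \<kappa>_bounds by (intro mult_left_mono) auto
    moreover have "b * c / 2 * \<delta> k / real k \<le> b * c / 2 * (norm z)\<^sup>2 / real k"
      using \<delta>_bounds parameter_relations c by (intro divide_right_mono mult_left_mono) auto
    moreover have "C / real k = \<kappa> / real k * M + b * c / 2 * (norm z)\<^sup>2 / real k"
      by (simp add: C_def add_divide_distrib)
    ultimately have "(real k)\<^sup>2 / 8 * q \<le> (E k + M) - (E (Suc k) + M) + C / real k"
      using elim(1) unfolding q_def mult_minus_right by linarith
    then have "\<beta> * ((real k)\<^sup>2 / 8 * q) \<le> \<beta> * ((E k + M) - (E (Suc k) + M) + C / real k)"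
      by (intro mult_left_mono) (auto simp: \<beta>_def)
    also have "\<dots> = \<beta> * (E k + M) - \<beta> * (E (Suc k) + M) + C * (\<beta> / real k)"
      by (simp add: algebra_simps)
    also have "\<dots> \<le> G k - G (Suc k) + C * (\<beta> / real k)"
      using elim s k unfolding G_def \<beta>_def
      by (auto intro!: mult_right_mono powr_mono2')
    also have "\<beta> / real k = real k powr (2 * s - 3)"
      using k by (simp add: \<beta>_def powr_diff powr_numeral power2_eq_square power3_eq_cube)
    also have "\<beta> * ((real k)\<^sup>2 / 8 * q) = real k powr (2 * s) * q / 8"
      using k by (simp add: \<beta>_def powr_diff powr_numeral)
    finally show ?case by (simp add: q_def)
  qed
  then show ?thesis by (rule summable_comparison_test_ev[OF _ sum])
qed

section \<open>Strong convergence and rates under an asymptotic lower bound on the norm\<close>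

context
  assumes \<delta>_lim: "\<delta> \<longlonglongrightarrow> 0"
begin

lemma E_plus_tendsto_0: "(\<lambda>k. E k + c / 2 * \<delta> k) \<longlonglongrightarrow> 0"
proof -
  have step: "\<forall>\<^sub>F k in sequentially. E (Suc k) \<le> E k - \<kappa> / real k * E k + b * c / 2 * \<delta> k / real k"
    using E_step by eventually_elim (smt (verit, best) divide_nonneg_nonneg mult_nonneg_nonneg zero_le_power2)
  have \<delta>c: "(\<lambda>k. a * \<delta> k) \<longlonglongrightarrow> 0" for a
    using tendsto_mult_right_zero[OF \<delta>_lim] by simp
  show ?thesis
  proof (rule order_tendstoI)
    fix a :: real assume "a < 0"
    have "0 \<le> E k + c / 2 * \<delta> k" for k
      using E_lower(2)[of k] zero_le_power2[of "norm (v k)"] by linarith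
    then show "\<forall>\<^sub>F k in sequentially. a < E k + c / 2 * \<delta> k"
      using \<open>a < 0\<close> by (meson eventuallyI less_le_trans)
  next
    fix a :: real assume a: "0 < a"
    have "\<forall>\<^sub>F k in sequentially. E k \<le> a / 2"
      by (rule contraction_limsup_nonpos[OF \<kappa>_bounds(1) step \<delta>c]) (use a in simp)
    moreover have "\<forall>\<^sub>F k in sequentially. c / 2 * \<delta> k < a / 2"
      by (rule order_tendstoD[OF \<delta>c]) (use a in simp)
    ultimately show "\<forall>\<^sub>F k in sequentially. E k + c / 2 * \<delta> k < a"
      by eventually_elim simp
  qed
qed

lemma x_tendsto: "x \<longlonglongrightarrow> z"
proof -
  have "(\<lambda>k. r * b / 2 * (norm (x (k - 1) - z))\<^sup>2) \<longlonglongrightarrow> 0"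
    by (rule tendsto_sandwich[OF _ _ tendsto_const E_plus_tendsto_0])
       (use E_lower(3) parameter_relations in auto)
  then have "(\<lambda>k. (norm (x (k - 1) - z))\<^sup>2) \<longlonglongrightarrow> 0"
    using tendsto_mult_left_iff[of "r * b / 2" "\<lambda>k. (norm (x (k - 1) - z))\<^sup>2" 0] parameter_relations by simp
  then have "(\<lambda>k. norm (x (k - 1) - z)) \<longlonglongrightarrow> 0" by simp
  from LIMSEQ_Suc[OF this] show ?thesis
    by (simp add: tendsto_norm_zero_iff LIM_zero_iff)
qed

lemma v_tendsto_0: "v \<longlonglongrightarrow> 0"
proof -
  have "(\<lambda>k. (norm (v k))\<^sup>2 / 2) \<longlonglongrightarrow> 0"
    by (rule tendsto_sandwich[OF _ _ tendsto_const E_plus_tendsto_0])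
       (use E_lower(2) in auto)
  then have "(\<lambda>k. (norm (v k))\<^sup>2) \<longlonglongrightarrow> 0"
    using tendsto_mult_left[of _ 0 sequentially 2] by fastforce
  then show ?thesis by (simp add: tendsto_norm_zero_iff)
qed

text \<open>
  Both \<open>v k\<close> and its first summand \<open>b (x (k - 1) - z)\<close> vanish in the limit, hence so does
  \<open>(k - 1) d k\<close>.
\<close>

lemma velocity_tendsto_0: "(\<lambda>k. real k * norm (d k)) \<longlonglongrightarrow> 0"
proof -
  have "(\<lambda>k. v k - b *\<^sub>R (x (k - 1) - z)) \<longlonglongrightarrow> 0 - b *\<^sub>R (z - z)"
    by (intro tendsto_intros v_tendsto_0)
       (use x_tendsto LIMSEQ_imp_Suc[of "\<lambda>k. x (k - 1)"] in simp)
  then have "(\<lambda>k. (real k - 1) *\<^sub>R d k) \<longlonglongrightarrow> 0" by (simp add: v_def)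
  moreover have "(\<lambda>k. real k / \<bar>real k - 1\<bar>) \<longlonglongrightarrow> 1" by real_asymp
  ultimately have "(\<lambda>k. norm ((real k - 1) *\<^sub>R d k) * (real k / \<bar>real k - 1\<bar>)) \<longlonglongrightarrow> 0 * 1"
    by (intro tendsto_mult tendsto_norm_zero)
  moreover have "\<forall>\<^sub>F k in sequentially.
      norm ((real k - 1) *\<^sub>R d k) * (real k / \<bar>real k - 1\<bar>) = real k * norm (d k)"
    using eventually_gt_at_top[of 1] by eventually_elim simp
  ultimately show ?thesis by (simp add: tendsto_cong)
qed

lemma energy_gap_tendsto_0: "(\<lambda>k. (real k)\<^sup>2 * \<phi> k) \<longlonglongrightarrow> 0"
proof -
  have "(\<lambda>k. (real k - 1)\<^sup>2 * \<phi> k) \<longlonglongrightarrow> 0"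
    by (rule tendsto_sandwich[OF _ _ tendsto_const E_plus_tendsto_0])
       (use E_lower(1) \<phi>_nonneg in auto)
  moreover have "(\<lambda>k. (real k)\<^sup>2 / (real k - 1)\<^sup>2) \<longlonglongrightarrow> 1" by real_asymp
  ultimately have "(\<lambda>k. (real k - 1)\<^sup>2 * \<phi> k * ((real k)\<^sup>2 / (real k - 1)\<^sup>2)) \<longlonglongrightarrow> 0 * 1"
    by (rule tendsto_mult)
  moreover have "\<forall>\<^sub>F k in sequentially.
      (real k - 1)\<^sup>2 * \<phi> k * ((real k)\<^sup>2 / (real k - 1)\<^sup>2) = (real k)\<^sup>2 * \<phi> k"
    using eventually_gt_at_top[of 1] by eventually_elim (simp add: field_simps)
  ultimately show ?thesis by (simp add: tendsto_cong)
qed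

text \<open>
  The iteration expresses \<open>g (Suc k)\<close> as \<open>d k - d (Suc k)\<close> up to terms \<open>(\<alpha>/k) d k\<close> and \<open>(c/k\<^sup>2) x k\<close>,
  which are \<open>O(k\<^sup>-\<^sup>2)\<close> because \<open>k |d k|\<close> and \<open>|x k|\<close> are bounded.
\<close>

lemma weighted_gradient_summable:
  assumes s: "s < 1"
  shows "summable (\<lambda>k. real (Suc k) powr (2 * s) * (norm (g (Suc k)))\<^sup>2)"
proof -
  define C where "C = \<bar>\<alpha>\<bar> + c * (norm z + 1)"
  have sum: "summable (\<lambda>k. 4 * (real k powr (2 * s) * (norm (d (Suc k) - d k))\<^sup>2)
      + 4 * C\<^sup>2 * real k powr (2 * s - 4))"
    using weighted_acceleration_summable[OF s] s
    by (intro summable_add summable_mult) (simp_all add: summable_real_powr_iff)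
  have "\<forall>\<^sub>F k in sequentially. real k * norm (d k) < 1"
    by (rule order_tendstoD[OF velocity_tendsto_0]) simp
  moreover have "\<forall>\<^sub>F k in sequentially. norm (x k) < norm z + 1"
    by (rule order_tendstoD[OF tendsto_norm[OF x_tendsto]]) simp
  moreover have "\<forall>\<^sub>F k in sequentially. real (Suc k) powr (2 * s) \<le> 2 * real k powr (2 * s)"
    by real_asymp
  ultimately have "\<forall>\<^sub>F k in sequentially. norm (real (Suc k) powr (2 * s) * (norm (g (Suc k)))\<^sup>2)
      \<le> 4 * (real k powr (2 * s) * (norm (d (Suc k) - d k))\<^sup>2) + 4 * C\<^sup>2 * real k powr (2 * s - 4)"
    using eventually_gt_at_top[of 0]
  proof eventually_elim
    case (elim k)
    define w where "w = norm (d (Suc k) - d k)"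
    have k: "0 < real k" "1 \<le> k" using elim by auto
    have geq: "g (Suc k) = - (d (Suc k) - d k) - (\<alpha> / real k) *\<^sub>R d k - (c / (real k)\<^sup>2) *\<^sub>R x k"
      using rec[OF k(2)] by (simp add: d_def algebra_simps)
    have "norm (g (Suc k)) \<le> w + norm ((\<alpha> / real k) *\<^sub>R d k) + norm ((c / (real k)\<^sup>2) *\<^sub>R x k)"
      unfolding geq w_def
      using norm_triangle_ineq4[of "- (d (Suc k) - d k) - (\<alpha> / real k) *\<^sub>R d k" "(c / (real k)\<^sup>2) *\<^sub>R x k"]
        norm_triangle_ineq4[of "- (d (Suc k) - d k)" "(\<alpha> / real k) *\<^sub>R d k"]
      unfolding norm_minus_cancel by linarith
    also have "norm ((\<alpha> / real k) *\<^sub>R d k) = \<bar>\<alpha>\<bar> / (real k)\<^sup>2 * (real k * norm (d k))"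
      using k by (simp add: power2_eq_square)
    also have "\<dots> \<le> \<bar>\<alpha>\<bar> / (real k)\<^sup>2 * 1"
      using elim by (intro mult_left_mono) auto
    also have "norm ((c / (real k)\<^sup>2) *\<^sub>R x k) \<le> c / (real k)\<^sup>2 * (norm z + 1)"
      using elim c by (auto intro!: divide_right_mono mult_left_mono)
    finally have "norm (g (Suc k)) \<le> w + C / (real k)\<^sup>2"
      by (simp add: C_def add_divide_distrib)
    then have "(norm (g (Suc k)))\<^sup>2 \<le> (w + C / (real k)\<^sup>2)\<^sup>2" by (intro power_mono) auto
    also have "\<dots> \<le> 2 * w\<^sup>2 + 2 * (C / (real k)\<^sup>2)\<^sup>2"
      using zero_le_power2[of "w - C / (real k)\<^sup>2"] by (simp add: power2_sum power2_diff)
    finally have "real (Suc k) powr (2 * s) * (norm (g (Suc k)))\<^sup>2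
        \<le> (2 * real k powr (2 * s)) * (2 * w\<^sup>2 + 2 * (C / (real k)\<^sup>2)\<^sup>2)"
      using elim by (intro mult_mono) auto
    also have "\<dots> = 4 * (real k powr (2 * s) * w\<^sup>2) + 4 * C\<^sup>2 * real k powr (2 * s - 4)"
      using k by (simp add: powr_diff powr_numeral power_divide algebra_simps flip: power_mult)
    finally show ?case by (simp add: w_def)
  qed
  then show ?thesis by (rule summable_comparison_test_ev[OF _ sum])
qed

end

end

section \<open>From scaled limits to the asymptotic statements\<close>

lemma smallo_powr_of_scaled_tendsto_0:
  fixes h :: "nat \<Rightarrow> real"
  assumes lim: "(\<lambda>k. real k powr a * h k) \<longlonglongrightarrow> 0" and ab: "e < a"
  shows "h \<in> o(\<lambda>k. real k powr (- e))"
proof (rule smalloI_tendsto)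
  have "(\<lambda>k. real k powr a * h k * real k powr (e - a)) \<longlonglongrightarrow> 0 * 0"
    by (intro tendsto_mult lim tendsto_neg_powr filterlim_real_sequentially) (use ab in simp)
  moreover have "\<forall>\<^sub>F k in sequentially. real k powr a * h k * real k powr (e - a) = h k / real k powr (- e)"
    using eventually_gt_at_top[of 0]
    by eventually_elim (simp add: powr_minus powr_diff field_simps)
  ultimately show "(\<lambda>k. h k / real k powr (- e)) \<longlonglongrightarrow> 0"
    by (simp add: tendsto_cong)
  show "\<forall>\<^sub>F k in sequentially. real k powr (- e) \<noteq> 0"
    using eventually_gt_at_top[of 0] by eventually_elim simp
qed

lemma square_deficit_tendsto_0:
  fixes h :: "nat \<Rightarrow> real"
  assumes h: "\<And>k. 0 \<le> h k" and low: "\<And>q. q < R \<Longrightarrow> \<forall>\<^sub>F k in sequentially. q < h k" and R: "0 \<le> R"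
  shows "(\<lambda>k. max 0 (R\<^sup>2 - (h k)\<^sup>2)) \<longlonglongrightarrow> 0"
proof (rule order_tendstoI)
  fix a :: real assume "a < 0"
  then show "\<forall>\<^sub>F k in sequentially. a < max 0 (R\<^sup>2 - (h k)\<^sup>2)"
    by (intro always_eventually allI) (simp add: less_max_iff_disj)
next
  fix a :: real assume a: "0 < a"
  have "\<forall>\<^sub>F k in sequentially. R - a / (2 * R + 1) < h k"
    using a R by (intro low) simp
  then show "\<forall>\<^sub>F k in sequentially. max 0 (R\<^sup>2 - (h k)\<^sup>2) < a"
  proof eventually_elim
    case (elim k)
    have "R\<^sup>2 - (h k)\<^sup>2 < a" if "h k < R"
    proof -
      have "R\<^sup>2 - (h k)\<^sup>2 = (R - h k) * (R + h k)" by (simp add: algebra_simps power2_eq_square)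
      also have "\<dots> \<le> (a / (2 * R + 1)) * (2 * R)"
        using elim that h[of k] R a by (intro mult_mono) auto
      also have "\<dots> < a" using a R by (simp add: field_simps)
      finally show ?thesis .
    qed
    moreover have "R\<^sup>2 - (h k)\<^sup>2 \<le> 0" if "R \<le> h k"
      using that R by (simp add: power_mono)
    ultimately show ?case using a by (cases "h k < R") auto
  qed
qed

lemma summable_of_square_bounded:
  fixes h :: "nat \<Rightarrow> real"
  assumes h: "\<And>k. 0 \<le> h k" and lim: "(\<lambda>k. (real k)\<^sup>2 * h k) \<longlonglongrightarrow> 0" and s: "s < 1"
  shows "summable (\<lambda>k. real (Suc k) powr (2 * s - 1) * h (Suc k))"
proof -
  have "\<forall>\<^sub>F k in sequentially. (real (Suc k))\<^sup>2 * h (Suc k) < 1"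
    by (rule order_tendstoD[OF LIMSEQ_Suc[OF lim]]) simp
  then have "\<forall>\<^sub>F k in sequentially. norm (real (Suc k) powr (2 * s - 1) * h (Suc k))
      \<le> real (Suc k) powr (2 * s - 3)"
  proof eventually_elim
    case (elim k)
    define t where "t = real (Suc k)"
    have t: "0 < t" by (simp add: t_def)
    have "t powr (2 * s - 1) * h (Suc k) = t powr (2 * s - 3) * (t\<^sup>2 * h (Suc k))"
      using t by (simp add: powr_diff powr_numeral power2_eq_square power3_eq_cube)
    also have "\<dots> \<le> t powr (2 * s - 3) * 1"
      using elim by (intro mult_left_mono) (auto simp: t_def)
    finally show ?case using h by (simp add: t_def)
  qed
  moreover have "summable (\<lambda>k. real (Suc k) powr (2 * s - 3))"
    using summable_Suc_iff[of "\<lambda>k. real k powr (2 * s - 3)"] s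
    by (simp add: summable_real_powr_iff)
  ultimately show ?thesis by (rule summable_comparison_test_ev)
qed

section \<open>The algorithm\<close>

text \<open>
  The relaxed proximal step with parameter \<open>lam + 1\<close> is an implicit gradient step of unit length on
  the Moreau envelope: the residual of the former, divided by \<open>lam + 1\<close>, is a subgradient at the point
  \<open>q\<close>, and \<open>X = q + lam g\<close> with that same subgradient \<open>g\<close>, so \<open>q\<close> is also the proximal point of \<open>X\<close> with
  parameter \<open>lam\<close>.
\<close>

lemma prox_relaxation_step:
  fixes f :: "'a::{real_inner,complete_space} \<Rightarrow> ereal"
  assumes f: "proper_fun f" "convex_fun f" "lsc_fun f"
    and m: "\<And>z. ereal m \<le> f z" and lam: "0 < lam"
    and X: "X = (lam / (1 + lam)) *\<^sub>R u + (1 / (1 + lam)) *\<^sub>R prox (lam + 1) f u"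
  shows "X = u - (1 / lam) *\<^sub>R (X - prox lam f X)"
proof -
  define q where "q = prox (lam + 1) f u"
  define g where "g = (1 / (lam + 1)) *\<^sub>R (u - q)"
  have u: "u = q + (lam + 1) *\<^sub>R g" using lam by (simp add: g_def)
  have "(lam / (1 + lam)) *\<^sub>R u = (lam / (1 + lam)) *\<^sub>R q + (lam / (1 + lam) * (lam + 1)) *\<^sub>R g"
    by (subst u) (simp only: scaleR_add_right scaleR_scaleR)
  moreover have "(lam / (1 + lam)) *\<^sub>R q + (1 / (1 + lam)) *\<^sub>R q = q" "lam / (1 + lam) * (lam + 1) = lam"
    using lam by (simp_all add: field_simps flip: scaleR_add_left)
  ultimately have X': "X = q + lam *\<^sub>R g"
    unfolding X q_def[symmetric] by (metis add.assoc add.commute)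
  have "subgradient f g q"
    using prox_subgradient[OF f m, of "lam + 1" u] lam by (simp add: g_def q_def)
  moreover have "(1 / lam) *\<^sub>R (X - q) = g" using X' lam by simp
  ultimately have "prox lam f X = q"
    by (intro subgradient_imp_prox_eq lam) simp
  then show ?thesis using X' u lam by (simp add: algebra_simps)
qed

(* Finiteness of the extended-real series in (ii) forces every gap with index at least 1 to be
   finite, so real_of_ereal in (i) loses no information. *)
theorem theorem14:
  fixes f :: "'a::{real_inner, complete_space} \<Rightarrow> ereal"
    and lam c \<alpha> s :: real
    and x y :: "nat \<Rightarrow> 'a"
  defines "p \<equiv> \<lambda>k. prox lam f (x k)"
    and "xs \<equiv> min_norm_elem (argmin_set f)"
  assumes "proper_fun f" and "convex_fun f" and "lsc_fun f"
    and "argmin_set f \<noteq> {}"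
    and "lam > 0" and "c > 0" and "\<alpha> > 3"
    and "ipatre_ns f lam c \<alpha> x y"
    and "s \<in> {1/2..<1}"
  shows
    "((\<lambda>k. real_of_ereal (gap f (p k))) \<in> o(\<lambda>k. real k powr (- 2 * s)) \<and>
      (\<lambda>k. norm (x k - x (k - 1))) \<in> o(\<lambda>k. real k powr (- s)) \<and>
      (\<lambda>k. norm (x k - p k)) \<in> o(\<lambda>k. real k powr (- s)))
     \<and>
     ((\<Sum>k. ereal (real (Suc k) powr (2 * s - 1)) * gap f (p (Suc k))) < \<infinity> \<and>
      summable (\<lambda>k. real (Suc k) powr (2 * s - 1) * (norm (x (Suc k) - x k))\<^sup>2) \<and>
      summable (\<lambda>k. real (Suc k) powr (2 * s) * (norm (x (Suc k) - p (Suc k)))\<^sup>2))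
     \<and>
     (liminf (\<lambda>k. ereal (norm (x k - xs))) = 0 \<and>
      ((\<forall>\<^sub>F k in sequentially. x k \<in> interior (ball 0 (norm xs))) \<or>
       (\<forall>\<^sub>F k in sequentially. x k \<in> - ball 0 (norm xs)) \<longrightarrow>
       x \<longlonglongrightarrow> xs))"
proof -
  note f = \<open>proper_fun f\<close> \<open>convex_fun f\<close> \<open>lsc_fun f\<close>
  note lam = \<open>lam > 0\<close>
  have s: "s < 1" using \<open>s \<in> {1/2..<1}\<close> by simp
  obtain z0 where z0: "\<And>w. f z0 \<le> f w"
    using \<open>argmin_set f \<noteq> {}\<close> by (auto simp: argmin_set_def is_arg_min_linorder)
  obtain m where m0: "f z0 = ereal m"
    using f(1) z0 unfolding proper_fun_def by (metis ereal_cases ereal_infty_less_eq(1))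
  have m: "ereal m \<le> f w" for w using z0[of w] m0 by simp
  have Inf: "(INF w. f w) = ereal m"
    by (rule antisym) (use m m0 in \<open>auto intro: INF_lower2[of z0] INF_greatest\<close>)
  have fxs: "f xs = ereal m"
    and xs_min: "\<And>w. f w \<le> ereal m \<Longrightarrow> norm xs \<le> norm w"
    unfolding xs_def by (rule min_norm_elem_argmin_set[OF f m0 m])+
  define g where "g k = (1 / lam) *\<^sub>R (x k - p k)" for k
  have sg: "subgradient f (g k) (p k)" for k
    unfolding g_def p_def by (rule prox_subgradient[OF f m lam])
  define h where "h k = real_of_ereal (f (p k)) - m" for k
  have fp: "f (p k) = ereal (h k + m)" for k
    using sg[of k] by (auto simp: subgradient_def h_def ereal_real)
  have h: "0 \<le> h k" for k using m[of "p k"] fp[of k] by simp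
  have gap: "gap f (p k) = ereal (h k)" for k
    by (simp add: gap_def Inf fp)
  define \<phi> where "\<phi> k = h k + (norm (x k - p k))\<^sup>2 / (2 * lam)" for k
  have h_le: "h k \<le> \<phi> k" and res_le: "(norm (x k - p k))\<^sup>2 \<le> 2 * lam * \<phi> k" for k
    using lam h[of k] by (auto simp: \<phi>_def field_simps)
  interpret tikhonov_inertial x g \<phi> xs \<alpha> c
  proof
    show "3 < \<alpha>" "0 < c" by fact+
    show "0 \<le> \<phi> k" for k using h[of k] lam by (simp add: \<phi>_def)
    fix k :: nat assume k: "1 \<le> k"
    have y: "y k = x k + (1 - \<alpha> / real k) *\<^sub>R (x k - x (k - 1))"
      and X: "x (Suc k) = (lam / (1 + lam)) *\<^sub>R (y k - (c / (real k)\<^sup>2) *\<^sub>R x k)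
          + (1 / (1 + lam)) *\<^sub>R prox (lam + 1) f (y k - (c / (real k)\<^sup>2) *\<^sub>R x k)"
      using \<open>ipatre_ns f lam c \<alpha> x y\<close> k by (simp_all add: ipatre_ns_def)
    have "x (Suc k) = y k - (c / (real k)\<^sup>2) *\<^sub>R x k - g (Suc k)"
      unfolding g_def p_def by (rule prox_relaxation_step[OF f m lam X])
    then show "x (Suc k) - x k
        = (1 - \<alpha> / real k) *\<^sub>R (x k - x (k - 1)) - g (Suc k) - (c / (real k)\<^sup>2) *\<^sub>R x k"
      unfolding y by simp
    show "g (Suc k) \<bullet> (x k - x (Suc k)) \<le> \<phi> k - \<phi> (Suc k)"
      using moreau_envelope_gradient_inequality[OF lam sg[unfolded g_def] fp fp, of "Suc k" "x k" k]
      by (simp add: g_def \<phi>_def)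
    show "\<phi> (Suc k) \<le> g (Suc k) \<bullet> (x (Suc k) - xs)"
      using moreau_envelope_gradient_inequality[OF lam sg[unfolded g_def] fxs fp, of "Suc k" xs]
      by (simp add: g_def \<phi>_def inner_diff_right)
  qed
  \<comment> \<open>The proximal points form a minimising sequence of \<open>f\<close> and approach the iterates, so the iterates
     inherit the asymptotic lower bound on the norm.\<close>
  have "(\<lambda>k. (norm (x k - p k))\<^sup>2) \<longlonglongrightarrow> 0"
    by (rule tendsto_sandwich[OF _ _ tendsto_const tendsto_mult_right_zero[OF \<phi>_tendsto_0, of "2 * lam"]])
       (use res_le in auto)
  then have res0: "(\<lambda>k. norm (x k - p k)) \<longlonglongrightarrow> 0" by simp
  have low: "\<forall>\<^sub>F k in sequentially. q < norm (x k)" if "q < norm xs" for q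
  proof -
    \<comment> \<open>Half of the margin is spent on the bound for \<open>p\<close>, half on the distance from \<open>p\<close> to \<open>x\<close>.\<close>
    define \<eta> where "\<eta> = (norm xs - q) / 2"
    have \<eta>: "q + \<eta> < norm xs" "0 < \<eta>"
      using that by (simp_all add: \<eta>_def field_simps)
    have "\<forall>\<^sub>F k in sequentially. q + \<eta> < norm (p k)"
    proof (rule minimizing_sequence_norm_lower_bound[OF f m xs_min])
      fix e :: real assume "0 < e"
      then have "\<forall>\<^sub>F k in sequentially. \<phi> k < e" by (rule order_tendstoD[OF \<phi>_tendsto_0])
      then show "\<forall>\<^sub>F k in sequentially. f (p k) \<le> ereal (m + e)"
      proof eventually_elim
        case (elim k)
        then show ?case using h_le[of k] by (simp add: fp)
      qed
    qed (use \<eta>(1) in simp_all)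
    moreover have "\<forall>\<^sub>F k in sequentially. norm (x k - p k) < \<eta>"
      by (rule order_tendstoD(2)[OF res0 \<eta>(2)])
    ultimately show ?thesis
    proof eventually_elim
      case (elim k)
      then show ?case using norm_triangle_ineq2[of "p k" "x k"] by (simp add: norm_minus_commute)
    qed
  qed
  have \<delta>_lim: "\<delta> \<longlonglongrightarrow> 0"
    using square_deficit_tendsto_0[of "\<lambda>k. norm (x k)" "norm xs"] low
    by (simp add: \<delta>_def[abs_def])
  note lims = x_tendsto[OF \<delta>_lim] velocity_tendsto_0[OF \<delta>_lim] energy_gap_tendsto_0[OF \<delta>_lim]
  have h_lim: "(\<lambda>k. (real k)\<^sup>2 * h k) \<longlonglongrightarrow> 0"
    by (rule tendsto_sandwich[OF _ _ tendsto_const lims(3)])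
       (use h h_le in \<open>auto intro!: always_eventually mult_left_mono\<close>)
  have "(\<lambda>k. (real k * norm (x k - p k))\<^sup>2) \<longlonglongrightarrow> 0"
  proof (rule tendsto_sandwich[OF _ _ tendsto_const tendsto_mult_right_zero[OF lims(3), of "2 * lam"]])
    show "\<forall>\<^sub>F k in sequentially. (real k * norm (x k - p k))\<^sup>2 \<le> 2 * lam * ((real k)\<^sup>2 * \<phi> k)"
    proof (intro always_eventually allI)
      fix k
      show "(real k * norm (x k - p k))\<^sup>2 \<le> 2 * lam * ((real k)\<^sup>2 * \<phi> k)"
        using mult_left_mono[OF res_le[of k], of "(real k)\<^sup>2"] by (simp add: power_mult_distrib mult_ac)
    qed
  qed simp
  then have res_lim: "(\<lambda>k. real k * norm (x k - p k)) \<longlonglongrightarrow> 0" by simp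
  have d_lim: "(\<lambda>k. real k * norm (x k - x (k - 1))) \<longlonglongrightarrow> 0"
    using lims(2) by (simp add: d_def)
  have powr1: "(\<lambda>k. real k powr 1 * F k) \<longlonglongrightarrow> 0" if "(\<lambda>k. real k * F k) \<longlonglongrightarrow> 0" for F :: "nat \<Rightarrow> real"
    using that by simp
  have powr2: "(\<lambda>k. real k powr 2 * h k) \<longlonglongrightarrow> 0" using h_lim by (simp add: powr_numeral)
  have i1: "(\<lambda>k. real_of_ereal (gap f (p k))) \<in> o(\<lambda>k. real k powr (- 2 * s))"
    using smallo_powr_of_scaled_tendsto_0[OF powr2, of "2 * s"] s by (simp add: gap)
  have i2: "(\<lambda>k. norm (x k - x (k - 1))) \<in> o(\<lambda>k. real k powr (- s))"
    by (rule smallo_powr_of_scaled_tendsto_0[OF powr1[OF d_lim] s])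
  have i3: "(\<lambda>k. norm (x k - p k)) \<in> o(\<lambda>k. real k powr (- s))"
    by (rule smallo_powr_of_scaled_tendsto_0[OF powr1[OF res_lim] s])
  have "summable (\<lambda>k. real (Suc k) powr (2 * s - 1) * h (Suc k))"
    by (rule summable_of_square_bounded[OF h h_lim s])
  then have ii1: "(\<Sum>k. ereal (real (Suc k) powr (2 * s - 1)) * gap f (p (Suc k))) < \<infinity>"
    by (simp add: gap suminf_ereal')
  have "(\<lambda>k. (real k)\<^sup>2 * (norm (x k - x (k - 1)))\<^sup>2) \<longlonglongrightarrow> 0"
    using tendsto_power[OF d_lim, of 2] by (simp add: power_mult_distrib)
  from summable_of_square_bounded[OF _ this s]
  have ii2: "summable (\<lambda>k. real (Suc k) powr (2 * s - 1) * (norm (x (Suc k) - x k))\<^sup>2)"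
    by simp
  have "norm (x k - p k) = lam * norm (g k)" for k using lam by (simp add: g_def)
  then have ii3: "summable (\<lambda>k. real (Suc k) powr (2 * s) * (norm (x (Suc k) - p (Suc k)))\<^sup>2)"
    using summable_mult[OF weighted_gradient_summable[OF \<delta>_lim s], of "lam\<^sup>2"]
    by (simp add: power_mult_distrib mult_ac)
  have "(\<lambda>k. norm (x k - xs)) \<longlonglongrightarrow> 0"
    using lims(1) by (simp add: tendsto_norm_zero_iff LIM_zero_iff)
  then have "liminf (\<lambda>k. ereal (norm (x k - xs))) = 0"
    by (intro lim_imp_Liminf) (simp_all add: zero_ereal_def)
  with i1 i2 i3 ii1 ii2 ii3 lims(1) show ?thesis by blast
qed

end
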